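(* Let $f=h+\overline{g}$ be a sense-preserving harmonic mapping defined in the unit disc $\mathbb{D}$, with dilatation $\omega=g'/h'$, such that for all $z\in\mathbb{D}$ $$(1-|z|^2)|zP_f(z)|+\frac{|z\omega'(z)|(1-|z|^2)}{1-|\omega(z)|^2}\le 1.$$ Then for all $a,b\in\mathbb{D}$, $$\frac13\left(\exp(3d(a,b))-1\right)\sqrt{Q(a)Q(b)}\ \ge\ |f(a)-f(b)|\ \ge\ \frac13\left(1-\exp(-3d(a,b))\right)\sqrt{R(a)R(b)}.$$
   Context: $\mathbb{D}=\{z\in\mathbb{C}:|z|<1\}$. A harmonic mapping on $\mathbb{D}$ is written $f=h+\overline{g}$ with $h,g$ analytic in $\mathbb{D}$ and $g(0)=0$. It is sense-preserving (and locally univalent) if its Jacobian $J_f=|h'|^2-|g'|^2$ is positive throughout $\mathbb{D}$; then $h'\ne0$ and the (second complex) dilatation $\omega=g'/h'$ is analytic in $\mathbb{D}$ with $|\omega|<1$. The pre-Schwarzian derivative of such $f$ is $$P_f=\frac{h''}{h'}-\frac{\overline{\omega}\,\omega'}{1-|\omega|^2}.$$ For $a,b\in\mathbb{D}$, $\rho(a,b)=\left|\frac{a-b}{1-\overline{a}b}\right|$ and $d(a,b)=\tanh^{-1}(\rho(a,b))=\frac12\log\frac{1+\rho(a,b)}{1-\rho(a,b)}$. Also $R(z)=(1-|z|^2)(|h'(z)|-|g'(z)|)$ and $Q(z)=(1-|z|^2)(|h'(z)|+|g'(z)|)$. *)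

theory Defs
  imports "HOL-Analysis.Analysis"
begin

abbreviation unit_disc :: "complex set" ("\<D>") where
  "\<D> \<equiv> ball 0 1"

(* h and g are the two analytic parts of the canonical decomposition of the harmonic
   mapping f; g 0 = 0 makes this decomposition unique. *)
definition harmonic_mapping ::
    "(complex \<Rightarrow> complex) \<Rightarrow> (complex \<Rightarrow> complex) \<Rightarrow> (complex \<Rightarrow> complex) \<Rightarrow> bool" where
  "harmonic_mapping f h g \<longleftrightarrow>
     h holomorphic_on \<D> \<and> g holomorphic_on \<D> \<and> g 0 = 0 \<and>
     (\<forall>z\<in>\<D>. f z = h z + cnj (g z))"

definition jacobian :: "(complex \<Rightarrow> complex) \<Rightarrow> (complex \<Rightarrow> complex) \<Rightarrow> complex \<Rightarrow> real" where
  "jacobian h g z = (cmod (deriv h z))\<^sup>2 - (cmod (deriv g z))\<^sup>2"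

definition sense_preserving :: "(complex \<Rightarrow> complex) \<Rightarrow> (complex \<Rightarrow> complex) \<Rightarrow> bool" where
  "sense_preserving h g \<longleftrightarrow> (\<forall>z\<in>\<D>. jacobian h g z > 0)"

definition dilatation :: "(complex \<Rightarrow> complex) \<Rightarrow> (complex \<Rightarrow> complex) \<Rightarrow> complex \<Rightarrow> complex" where
  "dilatation h g z = deriv g z / deriv h z"

definition pre_schwarzian :: "(complex \<Rightarrow> complex) \<Rightarrow> (complex \<Rightarrow> complex) \<Rightarrow> complex \<Rightarrow> complex" where
  "pre_schwarzian h g z =
     deriv (deriv h) z / deriv h z -
     cnj (dilatation h g z) * deriv (dilatation h g) z /
       of_real (1 - (cmod (dilatation h g z))\<^sup>2)"

definition pseudo_hyp_dist :: "complex \<Rightarrow> complex \<Rightarrow> real" where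
  "pseudo_hyp_dist a b = cmod ((a - b) / (1 - cnj a * b))"

definition hyp_dist :: "complex \<Rightarrow> complex \<Rightarrow> real" where
  "hyp_dist a b = artanh (pseudo_hyp_dist a b)"

definition R_fun :: "(complex \<Rightarrow> complex) \<Rightarrow> (complex \<Rightarrow> complex) \<Rightarrow> complex \<Rightarrow> real" where
  "R_fun h g z = (1 - (cmod z)\<^sup>2) * (cmod (deriv h z) - cmod (deriv g z))"

definition Q_fun :: "(complex \<Rightarrow> complex) \<Rightarrow> (complex \<Rightarrow> complex) \<Rightarrow> complex \<Rightarrow> real" where
  "Q_fun h g z = (1 - (cmod z)\<^sup>2) * (cmod (deriv h z) + cmod (deriv g z))"

end

theory Submission
  imports Defs "HOL-Complex_Analysis.Complex_Analysis"
begin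

text \<open>
  For a unimodular \<open>\<mu>\<close> the analytic function \<open>\<phi> = h + \<mu> g\<close> satisfies
  \<open>|\<phi>''/\<phi>' - P\<^sub>f| = |\<omega>'|/(1 - |\<omega>|\<^sup>2)\<close>, so the hypothesis gives Becker's condition
  \<open>(1 - |z|\<^sup>2)|z \<phi>''/\<phi>'| \<le> 1\<close>. Since \<open>|f(a) - f(b)|\<close> lies between
  \<open>||h(a) - h(b)| - |g(a) - g(b)||\<close> and \<open>|h(a) - h(b)| + |g(a) - g(b)|\<close>, and both are of the form
  \<open>|\<phi>(a) - \<phi>(b)|\<close> for suitable \<open>\<mu>\<close>, only analytic functions under Becker's condition remain.

  Such a function is univalent: after a dilation, the Ahlfors--Becker extension to the plane is a
  locally injective map which is nearly affine at infinity, hence injective. Moreover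
  \<open>|(1 - |z|\<^sup>2) \<phi>''/\<phi>' - 2 cnj z| \<le> 3\<close>, a condition invariant under automorphisms of the disc.
  At the origin it yields the growth bounds
  \<open>|\<phi>'(0)|(1 - exp(-3d))/3 \<le> |\<phi>(z) - \<phi>(0)| \<le> |\<phi>'(0)|(exp(3d) - 1)/3\<close> with \<open>d = d(0,z)\<close>, the lower
  one by univalence. Transporting them to \<open>a\<close> and to \<open>b\<close> bounds \<open>|\<phi>(a) - \<phi>(b)|\<close> by either
  endpoint, and the geometric mean lies between the two endpoint quantities.
\<close>

section \<open>Injectivity from local injectivity\<close>

text \<open>Moving outwards along \<open>v\<close>, or along any basis vector when
  \<open>v = 0\<close>, increases the norm, so no point of an open set has maximal norm.\<close>

lemma norm_direction_increasing:
  fixes v :: "'a::euclidean_space"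
  assumes "open S" "v \<in> S"
  obtains w where "w \<in> S" "norm v < norm w"
proof -
  obtain e where e: "e > 0" "cball v e \<subseteq> S"
    using assms open_contains_cball by blast
  obtain u :: 'a where u: "norm u = 1" "norm v < norm (v + e *\<^sub>R u)"
  proof (cases "v = 0")
    case True
    obtain b :: 'a where "b \<in> Basis" using nonempty_Basis by blast
    with True e show ?thesis by (intro that[of b]) auto
  next
    case False
    have "v + e *\<^sub>R (v /\<^sub>R norm v) = (1 + e / norm v) *\<^sub>R v"
      by (simp add: scaleR_add_left divide_inverse)
    then have "norm (v + e *\<^sub>R (v /\<^sub>R norm v)) = (1 + e / norm v) * norm v"
      using e by simp
    also have "\<dots> > norm v" using False e by (simp add: field_simps)
    finally show ?thesis using False by (intro that[of "v /\<^sub>R norm v"]) auto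
  qed
  have "v + e *\<^sub>R u \<in> cball v e" using u e by (simp add: dist_norm)
  then show ?thesis using that u e by blast
qed

text \<open>
  If injectivity fails, the pairs of distinct points with equal image form a compact set; since \<open>F\<close>
  is open near both members of a pair, \<open>norm (F x)\<close> has no maximum on it.
\<close>

lemma locally_injective_imp_injective:
  fixes F :: "'a::euclidean_space \<Rightarrow> 'a"
  assumes cont: "continuous_on UNIV F"
    and loc: "\<And>x. \<exists>U. open U \<and> x \<in> U \<and> inj_on F U"
    and bdd: "bounded {x. \<exists>y. y \<noteq> x \<and> F x = F y}"
  shows "inj F"
proof (rule ccontr)
  assume "\<not> inj F"
  define E where "E = {p. fst p \<noteq> snd p \<and> F (fst p) = F (snd p)}"
  have "E \<noteq> {}" using \<open>\<not> inj F\<close> unfolding inj_def E_def by auto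
  let ?B = "{x. \<exists>y. y \<noteq> x \<and> F x = F y}"
  have "E \<subseteq> ?B \<times> ?B" unfolding E_def by force
  then have "bounded E" using bdd bounded_Times bounded_subset by blast
  \<comment> \<open>Since \<open>E\<close> omits the diagonal, its closedness is not automatic:
    local injectivity keeps \<open>E\<close> away from the diagonal, and off the diagonal continuity
    of \<open>F\<close> suffices.\<close>
  have "open (- E)"
    unfolding open_subopen[of "- E"]
  proof
    fix p assume p: "p \<in> - E"
    show "\<exists>T. open T \<and> p \<in> T \<and> T \<subseteq> - E"
    proof (cases "fst p = snd p")
      case True
      obtain U where U: "open U" "fst p \<in> U" "inj_on F U" using loc by blast
      then have "p \<in> U \<times> U" using True by (simp add: mem_Times_iff)
      moreover have "U \<times> U \<subseteq> - E" using U(3) unfolding E_def inj_on_def by auto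
      ultimately show ?thesis using U(1) open_Times by blast
    next
      case False
      define T where "T = {q. F (fst q) \<noteq> F (snd q)}"
      have "continuous_on UNIV (\<lambda>q::'a \<times> 'a. F (fst q))"
           "continuous_on UNIV (\<lambda>q::'a \<times> 'a. F (snd q))"
        by (rule continuous_on_compose2[OF cont]; auto intro!: continuous_intros)+
      then have "open T" unfolding T_def using open_Collect_neq by blast
      moreover have "p \<in> T" using p False unfolding T_def E_def by auto
      moreover have "T \<subseteq> - E" unfolding T_def E_def by auto
      ultimately show ?thesis by blast
    qed
  qed
  then have "compact E" using \<open>bounded E\<close> compact_eq_bounded_closed closed_def by blast
  moreover have "continuous_on E (\<lambda>p. norm (F (fst p)))"
    by (intro continuous_intros continuous_on_compose2[OF cont]) auto
  ultimately obtain p where p: "p \<in> E" "\<And>q. q \<in> E \<Longrightarrow> norm (F (fst q)) \<le> norm (F (fst p))"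
    using continuous_attains_sup[of E "\<lambda>p. norm (F (fst p))"] \<open>E \<noteq> {}\<close> by blast
  have ne: "fst p \<noteq> snd p" and eq: "F (fst p) = F (snd p)" using p(1) unfolding E_def by auto
  obtain U1 U2 where U: "open U1" "fst p \<in> U1" "inj_on F U1" "open U2" "snd p \<in> U2" "inj_on F U2"
    using loc by metis
  obtain V1 V2 where V: "open V1" "open V2" "fst p \<in> V1" "snd p \<in> V2" "V1 \<inter> V2 = {}"
    using ne separation_t2 by metis
  \<comment> \<open>By invariance of domain the common value is interior to both images, so some
    \<open>w\<close> of larger norm is attained near both members of the pair. As \<open>V1\<close>
    and \<open>V2\<close> are disjoint, its two preimages differ.\<close>
  have "open (F ` (U1 \<inter> V1))" "open (F ` (U2 \<inter> V2))"
    using U V cont by (auto intro!: invariance_of_domain intro: continuous_on_subset inj_on_subset)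
  then have "open (F ` (U1 \<inter> V1) \<inter> F ` (U2 \<inter> V2))" by blast
  moreover have "F (fst p) \<in> F ` (U1 \<inter> V1) \<inter> F ` (U2 \<inter> V2)"
    using U V eq by (metis IntI imageI)
  ultimately obtain w where w: "w \<in> F ` (U1 \<inter> V1) \<inter> F ` (U2 \<inter> V2)" "norm (F (fst p)) < norm w"
    using norm_direction_increasing by blast
  from w(1) obtain x where x: "x \<in> V1" "F x = w" by auto
  from w(1) obtain y where y: "y \<in> V2" "F y = w" by auto
  have "(x, y) \<in> E" using x y V(5) unfolding E_def by auto
  then show False using p(2)[of "(x, y)"] w x by auto
qed

text \<open>Subtracting the real-linear map with coefficients \<open>A z0\<close> and
  \<open>B z0\<close> leaves a remainder \<open>E\<close> with Lipschitz constant
  \<open>2 * e\<close> near \<open>z0\<close>, because each coefficient varies there by less than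
  \<open>e\<close>. The linear map stretches distances by at least
  \<open>cmod (A z0) - cmod (B z0) = 3 * e\<close>, so \<open>F\<close> cannot identify two nearby
  points.\<close>

lemma locally_injective_wirtinger:
  fixes F :: "complex \<Rightarrow> complex"
  assumes der: "\<And>z. (F has_derivative (\<lambda>v. A z * v + B z * cnj v)) (at z)"
    and A: "isCont A z0" and B: "isCont B z0"
    and less: "cmod (B z0) < cmod (A z0)"
  shows "\<exists>U. open U \<and> z0 \<in> U \<and> inj_on F U"
proof -
  define e where "e = (cmod (A z0) - cmod (B z0)) / 3"
  have e: "e > 0" using less by (simp add: e_def)
  obtain d1 where d1: "d1 > 0" "\<And>z. dist z z0 < d1 \<Longrightarrow> dist (A z) (A z0) < e"
    using A e unfolding continuous_at_eps_delta by blast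
  obtain d2 where d2: "d2 > 0" "\<And>z. dist z z0 < d2 \<Longrightarrow> dist (B z) (B z0) < e"
    using B e unfolding continuous_at_eps_delta by blast
  define d where "d = min d1 d2"
  define E where "E = (\<lambda>z. F z - (A z0 * z + B z0 * cnj z))"
  have derE: "(E has_derivative (\<lambda>v. (A z - A z0) * v + (B z - B z0) * cnj v)) (at z within ball z0 d)" for z
    unfolding E_def
    by (rule derivative_eq_intros has_derivative_at_withinI[OF der] refl)+ (simp add: algebra_simps)
  have "onorm (\<lambda>v. (A z - A z0) * v + (B z - B z0) * cnj v) \<le> 2 * e" if "z \<in> ball z0 d" for z
  proof (rule onorm_le)
    fix v
    have "cmod ((A z - A z0) * v + (B z - B z0) * cnj v)
          \<le> cmod (A z - A z0) * cmod v + cmod (B z - B z0) * cmod v"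
      by (metis complex_mod_cnj norm_mult norm_triangle_ineq)
    also have "\<dots> \<le> e * cmod v + e * cmod v"
      using d1(2)[of z] d2(2)[of z] that
      by (intro add_mono mult_right_mono) (auto simp: d_def dist_norm norm_minus_commute)
    finally show "cmod ((A z - A z0) * v + (B z - B z0) * cnj v) \<le> 2 * e * cmod v" by simp
  qed
  then have lip: "cmod (E x - E y) \<le> 2 * e * cmod (x - y)" if "x \<in> ball z0 d" "y \<in> ball z0 d" for x y
    using differentiable_bound[OF convex_ball derE] that by blast
  have "inj_on F (ball z0 d)"
  proof (rule inj_onI, rule ccontr)
    fix x y assume xy: "x \<in> ball z0 d" "y \<in> ball z0 d" "F x = F y" "x \<noteq> y"
    have "E x - E y = - (A z0 * (x - y) + B z0 * cnj (x - y))"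
      using xy(3) by (simp add: E_def algebra_simps)
    then have "cmod (E x - E y) = cmod (A z0 * (x - y) + B z0 * cnj (x - y))"
      by (simp only: norm_minus_cancel)
    also have "\<dots> \<ge> cmod (A z0) * cmod (x - y) - cmod (B z0) * cmod (x - y)"
      by (metis complex_mod_cnj norm_mult norm_diff_ineq)
    also have "cmod (A z0) * cmod (x - y) - cmod (B z0) * cmod (x - y) = 3 * e * cmod (x - y)"
      by (simp add: e_def algebra_simps)
    finally have "3 * e * cmod (x - y) \<le> 2 * e * cmod (x - y)" using lip[OF xy(1,2)] by linarith
    then show False using e xy(4) by simp
  qed
  moreover have "d > 0" using d1 d2 by (simp add: d_def)
  ultimately show ?thesis by (intro exI[of _ "ball z0 d"]) auto
qed

section \<open>Becker's univalence criterion\<close>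

text \<open>Reflection in the unit circle outside, identity inside: one formula then describes the
  extension on the whole plane, since \<open>z - disc_reflect z\<close> vanishes on the closed
  disc.\<close>

definition disc_reflect :: "complex \<Rightarrow> complex" where
  "disc_reflect z = (if z \<in> cball 0 1 then z else inverse (cnj z))"

lemma norm_disc_reflect_le: "cmod (disc_reflect z) \<le> 1"
  by (auto simp: disc_reflect_def norm_inverse inverse_le_1_iff)

lemma continuous_on_disc_reflect: "continuous_on UNIV disc_reflect"
proof -
  have "continuous_on (cball 0 1 \<union> {z. 1 \<le> cmod z}) disc_reflect"
    unfolding disc_reflect_def
  proof (rule continuous_on_If)
    show "closed {z. 1 \<le> cmod z}" by (intro closed_Collect_le continuous_intros)
    show "continuous_on {z. 1 \<le> cmod z} (\<lambda>z. inverse (cnj z))"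
      by (intro continuous_intros) auto
    fix z :: complex assume "z \<in> {z. 1 \<le> cmod z}" "z \<in> cball 0 1"
    then have "cmod z = 1" by auto
    then have "z * cnj z = 1" by (simp add: complex_norm_square[symmetric])
    then show "z = inverse (cnj z)" by (metis inverse_unique mult.commute)
  qed (auto intro: continuous_intros)
  moreover have "cball 0 1 \<union> {z. 1 \<le> cmod z} = UNIV" by auto
  ultimately show ?thesis by simp
qed

text \<open>Outside the disc, z - 1/cnj z = (1 - 1/r^2) z with r = |z|. At the reflected point W
  this converts W^2 (z - W), the factor in the conjugate-linear part of the derivative of the
  extension, into Becker's weight |W| (1 - |W|^2).\<close>

lemma norm_mult_disc_reflect_diff:
  assumes "z \<notin> cball 0 1"
  shows "(cmod (disc_reflect z))\<^sup>2 * cmod (z - disc_reflect z)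
         = cmod (disc_reflect z) * (1 - (cmod (disc_reflect z))\<^sup>2)"
proof -
  have z: "cmod z > 1" using assms by simp
  then have zn: "z \<noteq> 0" by auto
  define r where "r = cmod z"
  have "z - inverse (cnj z) = of_real (1 - 1 / r\<^sup>2) * z"
  proof -
    have "of_real (r\<^sup>2) = z * cnj z" by (simp add: r_def complex_norm_square[symmetric])
    then have "1 / of_real (r\<^sup>2) * z = inverse (cnj z)" using zn by (simp add: field_simps)
    then show ?thesis by (simp add: algebra_simps)
  qed
  then have "cmod (z - inverse (cnj z)) = \<bar>1 - 1 / r\<^sup>2\<bar> * r"
    by (simp only: norm_mult norm_of_real r_def)
  moreover have "1 - 1 / r\<^sup>2 \<ge> 0" using z one_le_power[of r 2] by (simp add: r_def divide_le_eq_1)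
  ultimately have "cmod (z - inverse (cnj z)) = (1 - 1 / r\<^sup>2) * r" by simp
  moreover have "disc_reflect z = inverse (cnj z)" "cmod (inverse (cnj z)) = 1 / r"
    using assms unfolding norm_inverse by (auto simp: disc_reflect_def r_def inverse_eq_divide)
  moreover have "r > 0" using zn by (simp add: r_def)
  ultimately show ?thesis by (simp add: power2_eq_square)
qed

text \<open>
  The Ahlfors--Becker extension is continuously differentiable across the unit circle because the
  conjugate-linear part of its derivative carries the factor \<open>z - 1 / cnj z\<close>; Becker's condition says
  exactly that this part is dominated by the linear one.
\<close>

definition becker_extension :: "(complex \<Rightarrow> complex) \<Rightarrow> complex \<Rightarrow> complex" where
  "becker_extension k z =
     k (disc_reflect z) + (z - disc_reflect z) * deriv k (disc_reflect z)"

text \<open>Outside the disc, the derivatives of \<open>k (inverse (cnj z))\<close> and of the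
  factor \<open>- inverse (cnj z)\<close> produce two terms in \<open>deriv k\<close> that cancel,
  so the conjugate-linear part contains only the second derivative. By \<open>R > 1\<close> both
  branches are differentiable up to the circle; values and derivatives agree there, so the branches
  glue.\<close>

lemma has_derivative_becker_extension:
  assumes hol: "k holomorphic_on ball 0 R" and R: "R > 1"
  shows "(becker_extension k has_derivative
           (\<lambda>v. deriv k (disc_reflect z) * v +
             (- (disc_reflect z)\<^sup>2 * (z - disc_reflect z) * deriv (deriv k) (disc_reflect z)) * cnj v)) (at z)"
proof -
  define o1 where "o1 = (\<lambda>z. k (inverse (cnj z)) + (z - inverse (cnj z)) * deriv k (inverse (cnj z)))"
  define do1 where "do1 = (\<lambda>z v. deriv k (inverse (cnj z)) * v +
             (- (inverse (cnj z))\<^sup>2 * (z - inverse (cnj z)) * deriv (deriv k) (inverse (cnj z))) * cnj v)"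
  have ball: "w \<in> ball 0 R" if "cmod w \<le> 1" for w using that R by simp
  have k1: "(k has_field_derivative deriv k w) (at w)" if "cmod w \<le> 1" for w
    using hol ball[OF that] holomorphic_derivI by blast
  have k2: "(deriv k has_field_derivative deriv (deriv k) w) (at w)" if "cmod w \<le> 1" for w
    using holomorphic_deriv[OF hol] ball[OF that] holomorphic_derivI by blast
  have inner: "(k has_derivative (\<lambda>v. deriv k z * v)) (at z within S)" if "cmod z \<le> 1" for z S
    using k1[OF that] by (simp add: has_field_derivative_def has_derivative_at_withinI)
  have outer: "(o1 has_derivative do1 z) (at z within S)" if "cmod z \<ge> 1" for z S
  proof -
    have zn: "z \<noteq> 0" using that by auto
    have w: "cmod (inverse (cnj z)) \<le> 1" using that by (simp add: norm_inverse inverse_le_1_iff)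
    have dw: "((\<lambda>z. inverse (cnj z)) has_derivative (\<lambda>v. - (inverse (cnj z))\<^sup>2 * cnj v)) (at z)"
      using has_derivative_compose[OF has_derivative_cnj[OF has_derivative_ident] has_derivative_inverse'[of "cnj z"]] zn
      by (simp add: power2_eq_square mult_ac)
    have d1: "((\<lambda>z. k (inverse (cnj z))) has_derivative
               (\<lambda>v. deriv k (inverse (cnj z)) * (- (inverse (cnj z))\<^sup>2 * cnj v))) (at z)"
      using has_derivative_compose[OF dw k1[OF w, unfolded has_field_derivative_def]] by simp
    have d2: "((\<lambda>z. deriv k (inverse (cnj z))) has_derivative
               (\<lambda>v. deriv (deriv k) (inverse (cnj z)) * (- (inverse (cnj z))\<^sup>2 * cnj v))) (at z)"
      using has_derivative_compose[OF dw k2[OF w, unfolded has_field_derivative_def]] by simp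
    have "(o1 has_derivative do1 z) (at z)"
      unfolding o1_def do1_def
      by (rule derivative_eq_intros d1 d2 dw refl)+ (simp add: algebra_simps)
    then show ?thesis by (rule has_derivative_at_withinI)
  qed
  have eq: "inverse (cnj z) = z" if "cmod z = 1" for z
  proof -
    have "z * cnj z = 1" using that by (simp add: complex_norm_square[symmetric])
    then show ?thesis by (metis inverse_unique mult.commute)
  qed
  have ext: "becker_extension k = (\<lambda>z. if z \<in> cball 0 1 then k z else o1 z)"
    by (auto simp: becker_extension_def disc_reflect_def o1_def fun_eq_iff)
  have cl: "cmod x \<ge> 1" if "x \<in> closure (- cball 0 1)" for x :: complex
  proof -
    have "closure (- cball 0 1) \<subseteq> {x::complex. 1 \<le> cmod x}"
      by (rule closure_minimal) (auto intro!: closed_Collect_le continuous_intros)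
    then show ?thesis using that by auto
  qed
  have "((\<lambda>z. if z \<in> cball 0 1 then k z else o1 z) has_derivative
         (if z \<in> cball 0 1 then (\<lambda>v. deriv k z * v) else do1 z)) (at z within cball 0 1 \<union> - cball 0 1)"
  proof (rule has_derivative_If_within_closures)
    show "(k has_derivative (\<lambda>v. deriv k z * v)) (at z within cball 0 1 \<union> (closure (cball 0 1) \<inter> closure (- cball 0 1)))"
      if "z \<in> cball 0 1 \<union> (closure (cball 0 1) \<inter> closure (- cball 0 1))"
      using that by (intro inner) auto
    show "(o1 has_derivative do1 z) (at z within - cball 0 1 \<union> (closure (cball 0 1) \<inter> closure (- cball 0 1)))"
      if "z \<in> - cball 0 1 \<union> (closure (cball 0 1) \<inter> closure (- cball 0 1))"
      using that cl by (intro outer) force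
    show "k z = o1 z" if "z \<in> closure (cball 0 1)" "z \<in> closure (- cball 0 1)"
      using that cl[of z] eq[of z] by (simp add: o1_def)
    show "(\<lambda>v. deriv k z * v) = do1 z" if "z \<in> closure (cball 0 1)" "z \<in> closure (- cball 0 1)"
      using that cl[of z] eq[of z] by (simp add: do1_def)
  qed auto
  then show ?thesis
    unfolding ext by (auto simp: disc_reflect_def do1_def split: if_splits)
qed

section \<open>Behaviour of the extension near infinity\<close>

lemma lipschitz_on_holomorphic_disc:
  assumes "k holomorphic_on ball 0 R" "R > 1"
  obtains C where "C \<ge> 0"
    "\<And>x y. x \<in> cball 0 1 \<Longrightarrow> y \<in> cball 0 1 \<Longrightarrow> cmod (k x - k y) \<le> C * cmod (x - y)"
proof -
  have sub: "cball 0 1 \<subseteq> ball (0::complex) R" using assms(2) by auto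
  have "continuous_on (cball 0 1) (deriv k)"
    using assms sub holomorphic_deriv holomorphic_on_imp_continuous_on continuous_on_subset open_ball by metis
  then have "bounded (deriv k ` cball 0 1)"
    using compact_continuous_image compact_imp_bounded compact_cball by blast
  then obtain C where C: "\<And>w. w \<in> cball 0 1 \<Longrightarrow> cmod (deriv k w) \<le> C"
    unfolding bounded_iff by blast
  have "cmod (deriv k 0) \<le> C" by (rule C) simp
  then have "C \<ge> 0" using norm_ge_zero order_trans by blast
  moreover have "cmod (k x - k y) \<le> C * cmod (x - y)" if "x \<in> cball 0 1" "y \<in> cball 0 1" for x y
  proof (rule field_differentiable_bound[of "cball 0 1" k "deriv k"])
    show "(k has_field_derivative deriv k z) (at z within cball 0 1)" if "z \<in> cball 0 1" for z
      using that sub holomorphic_derivI[OF assms(1) open_ball] by blast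
  qed (use that C in auto)
  ultimately show ?thesis using that by blast
qed

text \<open>With u = 1/cnj x and v = 1/cnj y, the extension at x is (k(u) - u k'(u)) + x k'(u), and
  |u - v| = |x - y|/(|x||y|). The bracket contributes C1/|x|. The terms (x - y)(k'(u) - k'(0)) and y
  (k'(u) - k'(v)) contribute C2/|x| each, the first because |u| = 1/|x|.\<close>

lemma becker_extension_near_infinity:
  assumes hol: "k holomorphic_on ball 0 R" and R: "R > 1"
  obtains C where "C \<ge> 0"
    "\<And>x y. cmod x \<ge> 1 \<Longrightarrow> cmod y \<ge> 1 \<Longrightarrow>
       cmod (becker_extension k x - becker_extension k y - deriv k 0 * (x - y)) \<le> C / cmod x * cmod (x - y)"
proof -
  have hol': "deriv k holomorphic_on ball 0 R" using hol holomorphic_deriv by blast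
  obtain C1 where C1: "C1 \<ge> 0" "\<And>x y. x \<in> cball 0 1 \<Longrightarrow> y \<in> cball 0 1 \<Longrightarrow>
      cmod ((k x - x * deriv k x) - (k y - y * deriv k y)) \<le> C1 * cmod (x - y)"
    by (rule lipschitz_on_holomorphic_disc[of "\<lambda>w. k w - w * deriv k w" R])
       (use hol hol' R in \<open>auto intro!: holomorphic_intros\<close>)
  obtain C2 where C2: "C2 \<ge> 0" "\<And>x y. x \<in> cball 0 1 \<Longrightarrow> y \<in> cball 0 1 \<Longrightarrow>
      cmod (deriv k x - deriv k y) \<le> C2 * cmod (x - y)"
    using lipschitz_on_holomorphic_disc[OF hol' R] by blast
  have ext: "becker_extension k x =
      (k (inverse (cnj x)) - inverse (cnj x) * deriv k (inverse (cnj x))) + x * deriv k (inverse (cnj x))"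
    if "cmod x \<ge> 1" for x
  proof (cases "cmod x = 1")
    case True
    then have "x * cnj x = 1" by (simp add: complex_norm_square[symmetric])
    then have "inverse (cnj x) = x" by (metis inverse_unique mult.commute)
    then show ?thesis using True by (simp add: becker_extension_def disc_reflect_def)
  qed (use that in \<open>simp add: becker_extension_def disc_reflect_def algebra_simps\<close>)
  have "cmod (becker_extension k x - becker_extension k y - deriv k 0 * (x - y))
        \<le> (C1 + 2 * C2) / cmod x * cmod (x - y)" if xy: "cmod x \<ge> 1" "cmod y \<ge> 1" for x y
  proof -
    have nz: "x \<noteq> 0" "y \<noteq> 0" using xy by auto
    define u where "u = inverse (cnj x)"
    define v where "v = inverse (cnj y)"
    have uv: "u \<in> cball 0 1" "v \<in> cball 0 1"
      using xy by (auto simp: u_def v_def norm_inverse inverse_le_1_iff)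
    have "u - v = cnj (y - x) / (cnj x * cnj y)"
      using nz by (simp add: u_def v_def field_simps)
    then have duv: "cmod (u - v) = cmod (x - y) / (cmod x * cmod y)"
      by (simp only: norm_divide norm_mult complex_mod_cnj norm_minus_commute)
    have "becker_extension k x - becker_extension k y - deriv k 0 * (x - y) =
        ((k u - u * deriv k u) - (k v - v * deriv k v)) +
        ((x - y) * (deriv k u - deriv k 0) + y * (deriv k u - deriv k v))"
      unfolding ext[OF xy(1)] ext[OF xy(2)] u_def[symmetric] v_def[symmetric] by (simp add: algebra_simps)
    also have "cmod \<dots> \<le> cmod ((k u - u * deriv k u) - (k v - v * deriv k v)) +
        (cmod (x - y) * cmod (deriv k u - deriv k 0) + cmod y * cmod (deriv k u - deriv k v))"
      unfolding norm_mult[symmetric] by (intro order_trans[OF norm_triangle_ineq] add_left_mono norm_triangle_ineq)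
    also have "\<dots> \<le> C1 * cmod (u - v) + (cmod (x - y) * (C2 * cmod (u - 0)) + cmod y * (C2 * cmod (u - v)))"
      using C1(2)[OF uv] C2(2)[OF uv] C2(2)[OF uv(1), of 0]
      by (intro add_mono mult_left_mono) auto
    also have "\<dots> \<le> C1 * (cmod (x - y) / cmod x) + (cmod (x - y) * (C2 / cmod x) + C2 * cmod (x - y) / cmod x)"
    proof (intro add_mono mult_left_mono C1)
      have "cmod x \<le> cmod x * cmod y" using xy by (simp add: mult_le_cancel_left1)
      then show "cmod (u - v) \<le> cmod (x - y) / cmod x"
        unfolding duv using nz xy by (intro divide_left_mono) auto
      show "cmod y * (C2 * cmod (u - v)) \<le> C2 * cmod (x - y) / cmod x"
        unfolding duv using nz by simp
      show "C2 * cmod (u - 0) \<le> C2 / cmod x"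
        by (simp add: u_def norm_inverse divide_inverse)
    qed auto
    also have "\<dots> = (C1 + 2 * C2) / cmod x * cmod (x - y)"
      by (simp add: algebra_simps add_divide_distrib)
    finally show ?thesis .
  qed
  then show ?thesis using that[of "C1 + 2 * C2"] C1(1) C2(1) by auto
qed

text \<open>Strictness on the closed disc makes the linear part of the derivative of the extension
  dominate everywhere, which gives local injectivity. At the origin it gives
  \<open>deriv k 0 \<noteq> 0\<close>, so the estimate near infinity confines collisions to a
  bounded set. The extension is then injective, and it equals \<open>k\<close> on the closed
  disc.\<close>

lemma becker_univalence_strict:
  assumes hol: "k holomorphic_on ball 0 R" and R: "R > 1"
    and strict: "\<And>w. cmod w \<le> 1 \<Longrightarrow> (1 - (cmod w)\<^sup>2) * cmod (w * deriv (deriv k) w) < cmod (deriv k w)"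
  shows "inj_on k (cball 0 1)"
proof -
  let ?F = "becker_extension k" and ?W = disc_reflect
  define A where "A = (\<lambda>z. deriv k (?W z))"
  define B where "B = (\<lambda>z. - (?W z)\<^sup>2 * (z - ?W z) * deriv (deriv k) (?W z))"
  have der: "(?F has_derivative (\<lambda>v. A z * v + B z * cnj v)) (at z)" for z
    using has_derivative_becker_extension[OF hol R] unfolding A_def B_def .
  have cont: "continuous_on UNIV ?F"
    using der has_derivative_continuous continuous_at_imp_continuous_on by blast
  have Wim: "?W ` UNIV \<subseteq> ball 0 R" using norm_disc_reflect_le R by (force intro: le_less_trans)
  have hol': "deriv k holomorphic_on ball 0 R" using hol holomorphic_deriv by blast
  then have hol'': "deriv (deriv k) holomorphic_on ball 0 R" using holomorphic_deriv by blast
  have c1: "continuous_on UNIV (\<lambda>z. deriv k (?W z))"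
    using continuous_on_compose2[OF holomorphic_on_imp_continuous_on[OF hol'] continuous_on_disc_reflect Wim] .
  have c2: "continuous_on UNIV (\<lambda>z. deriv (deriv k) (?W z))"
    using continuous_on_compose2[OF holomorphic_on_imp_continuous_on[OF hol''] continuous_on_disc_reflect Wim] .
  have "continuous_on UNIV B"
    unfolding B_def by (intro continuous_intros c2 continuous_on_disc_reflect)
  then have isc: "isCont A z" "isCont B z" for z
    using c1 unfolding A_def by (auto simp: continuous_on_eq_continuous_at)
  have "cmod (B z) < cmod (A z)" for z
  proof -
    have "cmod (B z) \<le> (1 - (cmod (?W z))\<^sup>2) * cmod (?W z * deriv (deriv k) (?W z))"
    proof (cases "z \<in> cball 0 1")
      case True
      then have "cmod z * cmod z \<le> 1" by (simp add: mult_le_one)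
      with True show ?thesis by (simp add: B_def disc_reflect_def norm_mult power2_eq_square)
    next
      case False
      have "cmod (B z) = ((cmod (?W z))\<^sup>2 * cmod (z - ?W z)) * cmod (deriv (deriv k) (?W z))"
        by (simp add: B_def norm_mult norm_power)
      then show ?thesis
        unfolding norm_mult_disc_reflect_diff[OF False] by (simp add: norm_mult mult_ac)
    qed
    also have "\<dots> < cmod (A z)" unfolding A_def by (rule strict[OF norm_disc_reflect_le])
    finally show ?thesis .
  qed
  then have loc: "\<exists>U. open U \<and> z \<in> U \<and> inj_on ?F U" for z
    using locally_injective_wirtinger[OF der isc] by blast
  have c0: "cmod (deriv k 0) > 0" using strict[of 0] by simp
  obtain C where C: "C \<ge> 0" and
    lip: "\<And>x y. cmod x \<ge> 1 \<Longrightarrow> cmod y \<ge> 1 \<Longrightarrow>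
       cmod (?F x - ?F y - deriv k 0 * (x - y)) \<le> C / cmod x * cmod (x - y)"
    using becker_extension_near_infinity[OF hol R] by blast
  have "bounded (?F ` cball 0 1)"
    using compact_continuous_image compact_imp_bounded compact_cball continuous_on_subset cont
    by (metis subset_UNIV)
  then obtain M where M: "\<And>w. cmod w \<le> 1 \<Longrightarrow> cmod (?F w) \<le> M"
    unfolding bounded_iff by (metis image_eqI mem_cball_0)
  \<comment> \<open>One entry for each kind of collision of \<open>x\<close> with \<open>y\<close>:
    \<open>x\<close> in the closed disc, both points outside, only \<open>x\<close> outside. In the
    last case the estimate near infinity is applied to \<open>x\<close> and the auxiliary point 1,
    and \<open>M\<close> bounds the images of \<open>y\<close> and of 1.\<close>
  define K where "K = max 1 (max (C / cmod (deriv k 0)) ((2 * M + 2 * C) / cmod (deriv k 0) + 1))"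
  have "cmod x \<le> K" if ne: "y \<noteq> x" and eq: "?F x = ?F y" for x y
  proof -
    consider "cmod x \<le> 1" | "cmod x \<ge> 1" "cmod y \<ge> 1" | "cmod x \<ge> 1" "cmod y \<le> 1" by linarith
    then show ?thesis
    proof cases
      case 1
      then show ?thesis by (simp add: K_def)
    next
      case 2
      have xp: "cmod x > 0" using 2 by linarith
      have "cmod (deriv k 0) * cmod (x - y) \<le> C / cmod x * cmod (x - y)"
        using lip[OF 2] eq by (simp add: norm_mult)
      then have "cmod (deriv k 0) \<le> C / cmod x" by (rule mult_right_le_imp_le) (use ne in simp)
      then have "cmod x \<le> C / cmod (deriv k 0)"
        using xp c0 by (simp add: pos_le_divide_eq mult.commute)
      then show ?thesis by (simp add: K_def)
    next
      case 3
      have "cmod (x - 1) \<le> 2 * cmod x" using norm_triangle_ineq4[of x 1] 3 by simp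
      then have "C / cmod x * cmod (x - 1) \<le> C / cmod x * (2 * cmod x)"
        using C by (intro mult_left_mono) auto
      moreover have "C / cmod x * (2 * cmod x) = 2 * C" using 3(1) by (subst times_divide_eq_left) auto
      ultimately have le: "M + M + C / cmod x * cmod (x - 1) \<le> 2 * M + 2 * C" by linarith
      have "cmod (deriv k 0) * cmod (x - 1) =
            cmod ((?F x - ?F 1) - (?F x - ?F 1 - deriv k 0 * (x - 1)))" by (simp add: norm_mult)
      also have "\<dots> \<le> cmod (?F x) + cmod (?F 1) + cmod (?F x - ?F 1 - deriv k 0 * (x - 1))"
        by (meson add_right_mono norm_triangle_ineq4 order_trans)
      also have "\<dots> \<le> M + M + C / cmod x * cmod (x - 1)"
        using M[of y] M[of 1] lip[OF 3(1), of 1] 3 eq by (intro add_mono) auto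
      also note le
      finally have "cmod (x - 1) \<le> (2 * M + 2 * C) / cmod (deriv k 0)"
        using c0 by (simp add: field_simps)
      moreover have "cmod x \<le> cmod (x - 1) + 1" using norm_triangle_ineq[of "x - 1" 1] by simp
      ultimately show ?thesis by (simp add: K_def)
    qed
  qed
  then have "bounded {x. \<exists>y. y \<noteq> x \<and> ?F x = ?F y}" unfolding bounded_iff by blast
  then have "inj ?F" using locally_injective_imp_injective cont loc by blast
  show ?thesis
  proof (rule inj_onI)
    fix x y :: complex assume "x \<in> cball 0 1" "y \<in> cball 0 1" "k x = k y"
    then have "?F x = ?F y" by (simp add: becker_extension_def disc_reflect_def)
    then show "x = y" using \<open>inj ?F\<close> by (rule injD[rotated])
  qed
qed

text \<open>For r < 1 above |a| and |b|, the dilation f(rz) is holomorphic beyond the closed disc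
  and takes the values f(a), f(b) at a/r, b/r. Replacing 1 - |rw|^2 by the smaller 1 - |w|^2 makes
  the inequality strict; where the second derivative term vanishes, strictness comes from
  \<open>nz\<close>.\<close>

lemma becker_univalence:
  assumes hol: "f holomorphic_on \<D>"
    and nz: "\<And>z. z \<in> \<D> \<Longrightarrow> deriv f z \<noteq> 0"
    and becker: "\<And>z. z \<in> \<D> \<Longrightarrow> (1 - (cmod z)\<^sup>2) * cmod (z * deriv (deriv f) z / deriv f z) \<le> 1"
  shows "inj_on f \<D>"
proof (rule inj_onI)
  fix a b :: complex assume a: "a \<in> \<D>" and b: "b \<in> \<D>" and eq: "f a = f b"
  obtain r where r: "max (cmod a) (cmod b) < r" "r < 1"
    using a b dense[of "max (cmod a) (cmod b)" 1] by auto
  have r0: "r > 0" using r(1) norm_ge_zero[of a] by linarith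
  define k where "k = (\<lambda>z. f (of_real r * z))"
  have mem: "of_real r * w \<in> \<D>" if "w \<in> ball 0 (1/r)" for w :: complex
    using that r0 by (simp add: norm_mult pos_less_divide_eq mult.commute)
  have d1: "(k has_field_derivative of_real r * deriv f (of_real r * w)) (at w)" if "w \<in> ball 0 (1/r)" for w
    unfolding k_def
    using DERIV_chain2[OF holomorphic_derivI[OF hol open_ball mem[OF that]] DERIV_cmult_Id[of "of_real r"]]
    by (simp add: mult.commute)
  have dk: "deriv k w = of_real r * deriv f (of_real r * w)" if "w \<in> ball 0 (1/r)" for w
    using DERIV_imp_deriv[OF d1[OF that]] .
  have hol1: "deriv f holomorphic_on \<D>" using hol holomorphic_deriv by blast
  have d2: "((\<lambda>w. of_real r * deriv f (of_real r * w)) has_field_derivative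
     of_real r * (of_real r * deriv (deriv f) (of_real r * w))) (at w)" if "w \<in> ball 0 (1/r)" for w
    using DERIV_cmult[OF DERIV_chain2[OF holomorphic_derivI[OF hol1 open_ball mem[OF that]] DERIV_cmult_Id[of "of_real r"]],
        of "of_real r"]
    by (simp add: mult_ac)
  have ddk: "deriv (deriv k) w = of_real r * (of_real r * deriv (deriv f) (of_real r * w))"
    if "w \<in> ball 0 (1/r)" for w
  proof -
    have "eventually (\<lambda>x. deriv k x = of_real r * deriv f (of_real r * x)) (nhds w)"
      using eventually_nhds_in_open[OF open_ball that] by eventually_elim (rule dk)
    then have "deriv (deriv k) w = deriv (\<lambda>w. of_real r * deriv f (of_real r * w)) w"
      by (rule deriv_cong_ev) simp
    also have "\<dots> = of_real r * (of_real r * deriv (deriv f) (of_real r * w))"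
      using DERIV_imp_deriv[OF d2[OF that]] .
    finally show ?thesis .
  qed
  have "inj_on k (cball 0 1)"
  proof (rule becker_univalence_strict)
    show R: "1 / r > 1" using r r0 by simp
    show "k holomorphic_on ball 0 (1 / r)"
      using d1 unfolding holomorphic_on_open[OF open_ball] by blast
    fix w :: complex assume w: "cmod w \<le> 1"
    then have wb: "w \<in> ball 0 (1/r)" using R by simp
    define q where "q = of_real r * w"
    have qb: "q \<in> \<D>" using mem[OF wb] by (simp add: q_def)
    have q1: "1 - (cmod q)\<^sup>2 > 0" using qb by (simp add: power_less_one_iff abs_square_less_1)
    have fq: "cmod (deriv f q) > 0" using nz[OF qb] by simp
    have bq: "(1 - (cmod q)\<^sup>2) * cmod (q * deriv (deriv f) q) \<le> cmod (deriv f q)"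
      using becker[OF qb] fq by (simp add: norm_divide field_simps)
    show "(1 - (cmod w)\<^sup>2) * cmod (w * deriv (deriv k) w) < cmod (deriv k w)"
    proof (cases "w = 0")
      case True
      then show ?thesis using dk[OF wb] fq r0 by (simp add: q_def)
    next
      case False
      have "cmod q < cmod w" using False r r0 by (simp add: q_def norm_mult)
      then have lt: "1 - (cmod w)\<^sup>2 < 1 - (cmod q)\<^sup>2" by (simp add: power_strict_mono)
      have "(1 - (cmod w)\<^sup>2) * cmod (q * deriv (deriv f) q) < cmod (deriv f q)"
      proof (cases "cmod (q * deriv (deriv f) q) = 0")
        case True
        then show ?thesis using fq by (simp only: mult_zero_right)
      next
        case False
        then have "(1 - (cmod w)\<^sup>2) * cmod (q * deriv (deriv f) q) < (1 - (cmod q)\<^sup>2) * cmod (q * deriv (deriv f) q)"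
          using lt by (intro mult_strict_right_mono) auto
        then show ?thesis using bq by linarith
      qed
      then have "r * ((1 - (cmod w)\<^sup>2) * cmod (q * deriv (deriv f) q)) < r * cmod (deriv f q)"
        using r0 by simp
      moreover have "w * deriv (deriv k) w = of_real r * (q * deriv (deriv f) q)"
        unfolding ddk[OF wb] q_def by simp
      ultimately show ?thesis
        unfolding dk[OF wb] q_def[symmetric] using r0 by (simp add: norm_mult mult_ac)
    qed
  qed
  moreover have "k (a / of_real r) = k (b / of_real r)" using eq r0 by (simp add: k_def)
  moreover have "a / of_real r \<in> cball 0 1" "b / of_real r \<in> cball 0 1"
    using r r0 by (auto simp: norm_divide)
  ultimately have "a / of_real r = b / of_real r" by (metis inj_onD)
  then show "a = b" using r0 by simp
qed

section \<open>Growth and two-point distortion of analytic functions\<close>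

text \<open>
  Order at most \<open>\<beta> / 2\<close> in the sense of linearly invariant families.
\<close>

definition distortion_order :: "real \<Rightarrow> (complex \<Rightarrow> complex) \<Rightarrow> bool" where
  "distortion_order \<beta> f \<longleftrightarrow> f holomorphic_on \<D> \<and>
     (\<forall>z\<in>\<D>. deriv f z \<noteq> 0 \<and>
        cmod (of_real (1 - (cmod z)\<^sup>2) * (deriv (deriv f) z / deriv f z) - 2 * cnj z) \<le> \<beta>)"

section \<open>From Becker's condition to growth at the origin\<close>

lemma one_minus_norm_sq_pos:
  fixes z :: complex
  shows "z \<in> \<D> \<Longrightarrow> 0 < 1 - (cmod z)\<^sup>2"
  by (simp add: power_less_one_iff)

text \<open>The claim reduces to (1 - t^2)|q(z)| + 2t \<le> 3 with t = |z|. For t \<ge> 1/2 Becker's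
  condition bounds the left side by 1/t + 2t, which is at most 3 because (2t - 1)(1 - t) \<ge> 0.
  Near the origin that bound blows up, and the maximum principle takes over.\<close>

lemma becker_imp_distortion_order:
  assumes hol: "f holomorphic_on \<D>"
    and nz: "\<And>z. z \<in> \<D> \<Longrightarrow> deriv f z \<noteq> 0"
    and becker: "\<And>z. z \<in> \<D> \<Longrightarrow> (1 - (cmod z)\<^sup>2) * cmod (z * deriv (deriv f) z / deriv f z) \<le> 1"
  shows "distortion_order 3 f"
proof -
  define q where "q = (\<lambda>z. deriv (deriv f) z / deriv f z)"
  have qhol: "q holomorphic_on \<D>"
    unfolding q_def by (intro holomorphic_intros hol holomorphic_deriv nz) auto
  have zq: "(1 - (cmod z)\<^sup>2) * (cmod z * cmod (q z)) \<le> 1" if "z \<in> \<D>" for z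
    using becker[OF that] by (simp add: q_def norm_mult norm_divide)
  have main: "(1 - (cmod z)\<^sup>2) * cmod (q z) + 2 * cmod z \<le> 3" if z: "z \<in> \<D>" for z
  proof (cases "cmod z \<ge> 1/2")
    case True
    have "(2 * cmod z - 1) * (1 - cmod z) \<ge> 0" using True z by (intro mult_nonneg_nonneg) auto
    then have "1 + 2 * cmod z * cmod z \<le> 3 * cmod z" by (simp add: algebra_simps)
    moreover have "cmod z * ((1 - (cmod z)\<^sup>2) * cmod (q z)) \<le> 1" using zq[OF z] by (simp add: mult_ac)
    ultimately have "cmod z * ((1 - (cmod z)\<^sup>2) * cmod (q z) + 2 * cmod z) \<le> cmod z * 3"
      by (simp add: distrib_left mult_ac)
    then show ?thesis by (rule mult_left_le_imp_le) (use True in linarith)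
  next
    case False
    \<comment> \<open>The radius 3/5 approximates 1/sqrt 3, where r (1 - r^2) is largest and the
      bound from the circle is therefore best.\<close>
    have "cmod (q z) \<le> 1 / (3/5 * (1 - (3/5)\<^sup>2))"
    proof (rule maximum_modulus_frontier[of q "cball 0 (3/5)"])
      have sub: "cball 0 (3/5) \<subseteq> \<D>" by auto
      show "q holomorphic_on interior (cball 0 (3/5))"
        using qhol holomorphic_on_subset sub interior_subset by (metis (no_types) subset_trans)
      show "continuous_on (closure (cball 0 (3/5))) q"
        using qhol sub holomorphic_on_imp_continuous_on continuous_on_subset by (metis closed_cball closure_closed)
      show "z \<in> cball 0 (3/5)" using False by simp
      fix w :: complex assume "w \<in> frontier (cball 0 (3/5))"
      then have w: "cmod w = 3/5" by simp
      then have "w \<in> \<D>" by simp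
      from zq[OF this] show "cmod (q w) \<le> 1 / (3/5 * (1 - (3/5)\<^sup>2))"
        unfolding w by (simp add: power2_eq_square field_simps)
    qed simp
    then have "cmod (q z) \<le> 125/48" by (simp add: power2_eq_square)
    then have "(1 - (cmod z)\<^sup>2) * cmod (q z) \<le> (1 - (cmod z)\<^sup>2) * (125/48)"
      using one_minus_norm_sq_pos[OF z] by (intro mult_left_mono) auto
    \<comment> \<open>As a function of |z| the left side is largest at 48/125, with value 125/48 +
      48/125, just below 3.\<close>
    moreover have "(1 - (cmod z)\<^sup>2) * (125/48) + 2 * cmod z \<le> 3"
    proof -
      have "0 \<le> (cmod z)\<^sup>2 - 96/125 * cmod z + (48/125)\<^sup>2"
        using zero_le_power2[of "cmod z - 48/125"] by (simp add: power2_diff)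
      then show ?thesis by (simp add: power2_eq_square[of "48/125"] field_simps)
    qed
    ultimately show ?thesis by linarith
  qed
  have "cmod (of_real (1 - (cmod z)\<^sup>2) * q z - 2 * cnj z) \<le> 3" if z: "z \<in> \<D>" for z
  proof -
    have "cmod (of_real (1 - (cmod z)\<^sup>2) * q z - 2 * cnj z)
          \<le> cmod (of_real (1 - (cmod z)\<^sup>2) * q z) + cmod (2 * cnj z)" by (rule norm_triangle_ineq4)
    also have "\<dots> = (1 - (cmod z)\<^sup>2) * cmod (q z) + 2 * cmod z"
      using one_minus_norm_sq_pos[OF z] by (simp only: norm_mult norm_of_real complex_mod_cnj) simp
    finally show ?thesis using main[OF z] by linarith
  qed
  then show ?thesis using hol nz by (simp add: distortion_order_def q_def)
qed

text \<open>A logarithm of the zero-free derivative turns f''/f' into L' and ln |f'| into Re L,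
  which can be differentiated along radii.\<close>

lemma distortion_order_imp_log_deriv:
  assumes "distortion_order \<beta> f"
  obtains L where "L holomorphic_on \<D>" "\<And>z. z \<in> \<D> \<Longrightarrow> deriv f z = exp (L z)"
    "\<And>z. z \<in> \<D> \<Longrightarrow> cmod (of_real (1 - (cmod z)\<^sup>2) * deriv L z - 2 * cnj z) \<le> \<beta>"
proof -
  have hol: "deriv f holomorphic_on \<D>" using assms holomorphic_deriv unfolding distortion_order_def by blast
  have nz: "deriv f z \<noteq> 0" if "z \<in> \<D>" for z using assms that unfolding distortion_order_def by blast
  obtain L where L: "L holomorphic_on \<D>" "\<And>z. z \<in> \<D> \<Longrightarrow> deriv f z = exp (L z)"
    using contractible_imp_holomorphic_log[OF hol] nz convex_imp_contractible[OF convex_ball] by blast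
  have "deriv (deriv f) z / deriv f z = deriv L z" if z: "z \<in> \<D>" for z
  proof -
    have "((\<lambda>z. exp (L z)) has_field_derivative exp (L z) * deriv L z) (at z)"
      using holomorphic_derivI[OF L(1) open_ball z] by (auto intro!: derivative_eq_intros)
    then have "(deriv f has_field_derivative exp (L z) * deriv L z) (at z)"
      by (rule has_field_derivative_transform_within_open[OF _ open_ball z]) (simp add: L)
    then have "deriv (deriv f) z = exp (L z) * deriv L z" by (rule DERIV_imp_deriv)
    then show ?thesis using L(2)[OF z] by simp
  qed
  then show ?thesis using that L assms unfolding distortion_order_def by metis
qed

text \<open>Along a radius, \<open>A\<close> is the logarithm of (1 - t^2)|f'(tu)|, and its
  derivative is at most \<beta>/(1 - t^2) in modulus. Since this is the derivative of \<beta> artanh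
  t, both \<beta> artanh - A and \<beta> artanh + A are nondecreasing.\<close>

lemma radial_distortion:
  assumes ord: "distortion_order \<beta> f" and z: "z \<in> \<D>"
  shows "(1 - (cmod z)\<^sup>2) * cmod (deriv f z) \<le> cmod (deriv f 0) * exp (\<beta> * artanh (cmod z))"
    and "cmod (deriv f 0) * exp (- \<beta> * artanh (cmod z)) \<le> (1 - (cmod z)\<^sup>2) * cmod (deriv f z)"
proof -
  obtain L where L: "L holomorphic_on \<D>" "\<And>z. z \<in> \<D> \<Longrightarrow> deriv f z = exp (L z)"
    "\<And>z. z \<in> \<D> \<Longrightarrow> cmod (of_real (1 - (cmod z)\<^sup>2) * deriv L z - 2 * cnj z) \<le> \<beta>"
    using distortion_order_imp_log_deriv[OF ord] by metis
  define r where "r = cmod z"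
  \<comment> \<open>The direction must be unimodular even at the origin, where \<open>sgn\<close>
    gives 0.\<close>
  define u where "u = (if z = 0 then 1 else sgn z)"
  have u: "cmod u = 1" "z = of_real r * u"
    by (simp add: u_def norm_sgn, simp add: u_def r_def sgn_eq)
  have r: "0 \<le> r" "r < 1" using z by (auto simp: r_def)
  define A where "A = (\<lambda>t. ln (1 - t\<^sup>2) + Re (L (of_real t * u)))"
  define A' where "A' = (\<lambda>t. - 2 * t / (1 - t\<^sup>2) + Re (deriv L (of_real t * u) * u))"
  have dA: "(A has_real_derivative A' t) (at t)" and bA: "\<bar>A' t\<bar> \<le> \<beta> * (1 / (1 - t\<^sup>2))"
    if t: "0 \<le> t" "t \<le> r" for t
  proof -
    have tu: "of_real t * u \<in> \<D>" using t r u by (simp add: norm_mult)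
    have nt: "cmod (of_real t * u) = t" using t u by (simp add: norm_mult)
    have t1: "1 - t\<^sup>2 > 0" using one_minus_norm_sq_pos[OF tu] nt by simp
    have "((\<lambda>t. L (of_real t * u)) has_vector_derivative u * deriv L (of_real t * u)) (at t)"
      by (rule field_vector_diff_chain_at[of "\<lambda>t. of_real t * u" u t L "deriv L (of_real t * u)", unfolded o_def])
         (auto intro!: derivative_eq_intros holomorphic_derivI[OF L(1) open_ball tu])
    then have "((\<lambda>t. Re (L (of_real t * u))) has_real_derivative Re (deriv L (of_real t * u) * u)) (at t)"
      by (simp add: has_real_derivative_iff_has_vector_derivative mult.commute has_vector_derivative_complex_iff)
    then show "(A has_real_derivative A' t) (at t)"
      unfolding A_def A'_def using t1
      by (intro DERIV_add) (auto intro!: derivative_eq_intros)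
    define w where "w = deriv L (of_real t * u) * u"
    have uu: "cnj u * u = 1" using u(1) by (metis complex_norm_square mult.commute of_real_1 one_power2)
    \<comment> \<open>Multiplying by \<open>u\<close> turns 2 cnj (tu) into the real number 2t, so
      the real part of the order condition controls (1 - t^2) A'(t).\<close>
    have "of_real (1 - t\<^sup>2) * w - of_real (2 * t) =
       (of_real (1 - t\<^sup>2) * deriv L (of_real t * u) - 2 * cnj (of_real t * u)) * u"
      using uu by (simp add: w_def algebra_simps)
    then have "cmod (of_real (1 - t\<^sup>2) * w - of_real (2 * t)) \<le> \<beta>"
      using L(3)[OF tu] u(1) nt by (simp only: norm_mult mult_1_right)
    then have "\<bar>Re (of_real (1 - t\<^sup>2) * w - of_real (2 * t))\<bar> \<le> \<beta>"
      using abs_Re_le_cmod order_trans by blast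
    then have "\<bar>(1 - t\<^sup>2) * Re w - 2 * t\<bar> \<le> \<beta>" by simp
    moreover have "A' t = ((1 - t\<^sup>2) * Re w - 2 * t) / (1 - t\<^sup>2)"
      using t1 by (simp add: A'_def w_def field_simps)
    ultimately show "\<bar>A' t\<bar> \<le> \<beta> * (1 / (1 - t\<^sup>2))"
      using t1 by (simp add: abs_divide divide_right_mono)
  qed
  have dar: "((\<lambda>t. \<beta> * artanh t) has_real_derivative \<beta> * (1 / (1 - t\<^sup>2))) (at t)"
    if "0 \<le> t" "t \<le> r" for t
    using that r by (intro DERIV_cmult artanh_real_has_field_derivative) auto
  have "\<beta> * artanh 0 - A 0 \<le> \<beta> * artanh r - A r"
  proof (rule DERIV_nonneg_imp_nondecreasing[OF r(1)])
    fix t assume t: "0 \<le> t" "t \<le> r"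
    show "\<exists>y. ((\<lambda>t. \<beta> * artanh t - A t) has_real_derivative y) (at t) \<and> y \<ge> 0"
      using DERIV_diff[OF dar[OF t] dA[OF t]] bA[OF t] by (intro exI conjI) (assumption, linarith)
  qed
  moreover have "\<beta> * artanh 0 + A 0 \<le> \<beta> * artanh r + A r"
  proof (rule DERIV_nonneg_imp_nondecreasing[OF r(1)])
    fix t assume t: "0 \<le> t" "t \<le> r"
    show "\<exists>y. ((\<lambda>t. \<beta> * artanh t + A t) has_real_derivative y) (at t) \<and> y \<ge> 0"
      using DERIV_add[OF dar[OF t] dA[OF t]] bA[OF t] by (intro exI conjI) (assumption, linarith)
  qed
  ultimately have A: "A r \<le> A 0 + \<beta> * artanh r" "A 0 + (- \<beta> * artanh r) \<le> A r" by simp_all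
  have "A r = ln (1 - r\<^sup>2) + Re (L z)" by (simp add: A_def flip: u(2))
  then have expr: "exp (A r) = (1 - r\<^sup>2) * cmod (deriv f z)"
    using one_minus_norm_sq_pos[OF z] L(2)[OF z] by (simp add: exp_add r_def)
  have exp0: "exp (A 0) = cmod (deriv f 0)" using L(2)[of 0] by (simp add: A_def)
  show "(1 - (cmod z)\<^sup>2) * cmod (deriv f z) \<le> cmod (deriv f 0) * exp (\<beta> * artanh (cmod z))"
    using A(1)[THEN exp_le_cancel_iff[THEN iffD2]] unfolding exp_add expr exp0 unfolding r_def .
  show "cmod (deriv f 0) * exp (- \<beta> * artanh (cmod z)) \<le> (1 - (cmod z)\<^sup>2) * cmod (deriv f z)"
    using A(2)[THEN exp_le_cancel_iff[THEN iffD2]] unfolding exp_add expr exp0 unfolding r_def .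
qed

text \<open>The upper radial distortion bound is integrated along the radius: \<phi> is an explicit
  primitive of the majorant, because artanh has derivative 1/(1 - t^2).\<close>

lemma growth_upper:
  assumes ord: "distortion_order \<beta> f" and \<beta>: "\<beta> > 0" and z: "z \<in> \<D>"
  shows "cmod (f z - f 0) \<le> cmod (deriv f 0) * (exp (\<beta> * artanh (cmod z)) - 1) / \<beta>"
proof (cases "z = 0")
  case False
  define r where "r = cmod z"
  define u where "u = sgn z"
  have u: "cmod u = 1" "z = of_real r * u" using False
    by (simp add: u_def norm_sgn, simp add: u_def r_def sgn_eq)
  have r: "0 < r" "r < 1" using z False by (auto simp: r_def)
  have hol: "f holomorphic_on \<D>" using ord by (simp add: distortion_order_def)
  define \<phi> where "\<phi> = (\<lambda>t. cmod (deriv f 0) / \<beta> * exp (\<beta> * artanh t))"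
  have df: "((\<lambda>t. f (of_real t * u)) has_vector_derivative u * deriv f (of_real t * u)) (at t)"
    and d\<phi>: "(\<phi> has_vector_derivative cmod (deriv f 0) * exp (\<beta> * artanh t) / (1 - t\<^sup>2)) (at t)"
    and le: "cmod (u * deriv f (of_real t * u)) \<le> cmod (deriv f 0) * exp (\<beta> * artanh t) / (1 - t\<^sup>2)"
    if t: "0 \<le> t" "t \<le> r" for t
  proof -
    have tu: "of_real t * u \<in> \<D>" using t r u by (simp add: norm_mult)
    have nt: "cmod (of_real t * u) = t" using t u by (simp add: norm_mult)
    have t1: "1 - t\<^sup>2 > 0" using one_minus_norm_sq_pos[OF tu] nt by simp
    show "((\<lambda>t. f (of_real t * u)) has_vector_derivative u * deriv f (of_real t * u)) (at t)"
      by (rule field_vector_diff_chain_at[of "\<lambda>t. of_real t * u" u t f "deriv f (of_real t * u)", unfolded o_def])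
         (auto intro!: derivative_eq_intros holomorphic_derivI[OF hol open_ball tu])
    have "(artanh has_real_derivative 1 / (1 - t\<^sup>2)) (at t)"
      using t r by (intro artanh_real_has_field_derivative) auto
    then have "(\<phi> has_real_derivative cmod (deriv f 0) / \<beta> * (exp (\<beta> * artanh t) * (\<beta> * (1 / (1 - t\<^sup>2))))) (at t)"
      unfolding \<phi>_def by (intro DERIV_cmult DERIV_fun_exp)
    then show "(\<phi> has_vector_derivative cmod (deriv f 0) * exp (\<beta> * artanh t) / (1 - t\<^sup>2)) (at t)"
      using \<beta> by (simp add: has_real_derivative_iff_has_vector_derivative)
    show "cmod (u * deriv f (of_real t * u)) \<le> cmod (deriv f 0) * exp (\<beta> * artanh t) / (1 - t\<^sup>2)"
      using radial_distortion(1)[OF ord tu] t1 u(1) nt by (simp add: norm_mult pos_le_divide_eq mult.commute)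
  qed
  have "cmod (f (of_real r * u) - f (of_real 0 * u)) \<le> \<phi> r - \<phi> 0"
  proof (rule differentiable_bound_general[OF r(1)])
    show "continuous_on {0..r} (\<lambda>t. f (of_real t * u))"
      using df has_vector_derivative_continuous continuous_at_imp_continuous_on by (metis atLeastAtMost_iff)
    show "continuous_on {0..r} \<phi>"
      using d\<phi> has_vector_derivative_continuous continuous_at_imp_continuous_on by (metis atLeastAtMost_iff)
    show "((\<lambda>t. f (of_real t * u)) has_vector_derivative u * deriv f (of_real t * u)) (at t)"
         "(\<phi> has_vector_derivative cmod (deriv f 0) * exp (\<beta> * artanh t) / (1 - t\<^sup>2)) (at t)"
         "cmod (u * deriv f (of_real t * u)) \<le> cmod (deriv f 0) * exp (\<beta> * artanh t) / (1 - t\<^sup>2)"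
      if "0 < t" "t < r" for t
      using that by (intro df d\<phi> le; simp)+
  qed
  then have "cmod (f z - f 0) \<le> \<phi> r - \<phi> 0" by (simp flip: u(2))
  then show ?thesis by (simp add: \<phi>_def r_def diff_divide_distrib right_diff_distrib)
qed simp

text \<open>
  At a point of the circle through \<open>z\<close> where \<open>|f - f 0|\<close> is smallest, the segment from \<open>f 0\<close> to its
  image lies in the image of the disc; its preimage is compared with the radial lower bound.
\<close>

lemma growth_lower:
  assumes ord: "distortion_order \<beta> f" and \<beta>: "\<beta> > 0" and inj: "inj_on f \<D>" and z: "z \<in> \<D>"
  shows "cmod (deriv f 0) * (1 - exp (- \<beta> * artanh (cmod z))) / \<beta> \<le> cmod (f z - f 0)"
proof (cases "z = 0")
  case False
  define r where "r = cmod z"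
  have r: "0 < r" "r < 1" using z False by (auto simp: r_def)
  have hol: "f holomorphic_on \<D>" using ord by (simp add: distortion_order_def)
  have cont: "continuous_on \<D> f" using hol holomorphic_on_imp_continuous_on by blast
  have sph: "sphere 0 r \<subseteq> \<D>" using r by auto
  have "\<exists>\<zeta>\<in>sphere 0 r. \<forall>y\<in>sphere 0 r. cmod (f \<zeta> - f 0) \<le> cmod (f y - f 0)"
    by (rule continuous_attains_inf)
       (use r sph cont in \<open>auto intro!: continuous_intros intro: continuous_on_subset\<close>)
  then obtain \<zeta> where \<zeta>: "cmod \<zeta> = r" and
    min: "\<And>y. cmod y = r \<Longrightarrow> cmod (f \<zeta> - f 0) \<le> cmod (f y - f 0)"
    by auto
  define l where "l = cmod (f \<zeta> - f 0)"
  have \<zeta>D: "\<zeta> \<in> \<D>" using \<zeta> r by simp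
  have "f \<zeta> \<noteq> f 0" using inj \<zeta>D \<zeta> r inj_onD[OF inj, of \<zeta> 0] by auto
  then have l: "l > 0" by (simp add: l_def)
  define d where "d = sgn (f \<zeta> - f 0)"
  have d: "cmod d = 1" "f \<zeta> = f 0 + of_real l * d"
    using \<open>f \<zeta> \<noteq> f 0\<close> by (simp add: d_def norm_sgn, simp add: d_def l_def sgn_eq)
  \<comment> \<open>By minimality of \<open>l\<close> the image of the circle keeps distance at
    least \<open>l\<close> from \<open>f 0\<close>, so the open image of the inner disc covers the
    ball.\<close>
  have "ball (f 0) l \<subseteq> f ` ball 0 r"
  proof (rule ball_subset_open_map_image)
    show "continuous_on (closure (ball 0 r)) f"
      using r by (intro continuous_on_subset[OF cont]) auto
    have "ball 0 r \<subseteq> \<D>" using r by auto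
    then show "open (f ` interior (ball 0 r))"
      using open_mapping_thm3[of f "ball 0 r"] holomorphic_on_subset[OF hol] inj_on_subset[OF inj] by simp
    show "l \<le> cmod (f w - f 0)" if "w \<in> frontier (ball 0 r)" for w
      using that r min by (simp add: l_def)
  qed (use r l in auto)
  then have ball: "ball (f 0) l \<subseteq> f ` \<D>" using r by force
  define p where "p = (\<lambda>s. f 0 + of_real s * d)"
  have pim: "p s \<in> f ` \<D>" if "0 \<le> s" "s \<le> l" for s
  proof (cases "s = l")
    case True
    then show ?thesis using d(2) \<zeta>D by (metis image_eqI p_def)
  next
    case False
    then have "p s \<in> ball (f 0) l" using that d by (simp add: p_def dist_norm norm_mult)
    then show ?thesis using ball by blast
  qed
  obtain G where G: "G holomorphic_on (f ` \<D>)" "\<And>w. w \<in> \<D> \<Longrightarrow> deriv f w * deriv G (f w) = 1"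
      "\<And>w. w \<in> \<D> \<Longrightarrow> G (f w) = w"
    using holomorphic_has_inverse[OF hol open_ball inj] by metis
  have ofim: "open (f ` \<D>)" using open_mapping_thm3[OF hol open_ball inj] .
  define Z where "Z = (\<lambda>s. G (p s))"
  have Z: "Z s \<in> \<D>" "f (Z s) = p s" if "0 \<le> s" "s \<le> l" for s
    using pim[OF that] G(3) by (auto simp: Z_def)
  have dZ: "(Z has_vector_derivative d * deriv G (p s)) (at s)" if "0 \<le> s" "s \<le> l" for s
    unfolding Z_def
    by (rule field_vector_diff_chain_at[of p d s G "deriv G (p s)", unfolded o_def])
       (auto simp: p_def intro!: derivative_eq_intros holomorphic_derivI[OF G(1) ofim pim[OF that, unfolded p_def]])
  \<comment> \<open>\<psi> is the claimed lower bound evaluated at the preimage \<open>Z s\<close>.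
    Its derivative is at most |f'(Z s)||Z'(s)| = 1 by the radial lower bound, so s - \<psi>(s) is
    nondecreasing; the endpoint s = l, where \<open>Z l = \<zeta>\<close>, gives the claim.\<close>
  define \<psi> where "\<psi> = (\<lambda>s. cmod (deriv f 0) / \<beta> * (1 - exp (- \<beta> * artanh (cmod (Z s)))))"
  have "0 - \<psi> 0 \<le> l - \<psi> l"
  \<comment> \<open>Only the open interval is differentiated, because the norm is not differentiable
    at \<open>Z 0 = 0\<close>.\<close>
  proof (rule DERIV_nonneg_imp_increasing_open[of 0 l "\<lambda>s. s - \<psi> s"])
    have "continuous_on {0..l} Z"
      using dZ has_vector_derivative_continuous continuous_at_imp_continuous_on by (metis atLeastAtMost_iff)
    then show "continuous_on {0..l} (\<lambda>s. s - \<psi> s)"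
      unfolding \<psi>_def using Z(1)
      by (intro continuous_intros) (auto intro: less_le_trans[OF _ norm_ge_zero])
    fix s :: real assume s: "0 < s" "s < l"
    define v where "v = d * deriv G (p s)"
    define N where "N = cmod (Z s)"
    have ZD: "Z s \<in> \<D>" and fZ: "f (Z s) = p s" using Z s by auto
    have "p s \<noteq> f 0" using s d by (auto simp: p_def)
    then have Z0: "Z s \<noteq> 0" using fZ by auto
    have N1: "1 - N\<^sup>2 > 0" using one_minus_norm_sq_pos[OF ZD] by (simp add: N_def)
    have "deriv f (Z s) * deriv G (p s) = 1" using G(2)[OF ZD] fZ by simp
    then have "cmod (deriv f (Z s)) * cmod (deriv G (p s)) = 1" by (metis norm_mult norm_one)
    then have v: "cmod (deriv f (Z s)) * cmod v = 1" using d by (simp add: v_def norm_mult)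
    have "(Z has_derivative (\<lambda>t. t *\<^sub>R v)) (at s)"
      using dZ[of s] s by (simp add: has_vector_derivative_def v_def)
    then have "((\<lambda>s. cmod (Z s)) has_derivative (\<lambda>t. inner (t *\<^sub>R v) (sgn (Z s)))) (at s)"
      using has_derivative_compose[of Z "\<lambda>t. t *\<^sub>R v" s UNIV cmod "\<lambda>y. inner y (sgn (Z s))"]
        has_derivative_norm[OF Z0] by blast
    then have dN: "((\<lambda>s. cmod (Z s)) has_real_derivative inner v (sgn (Z s))) (at s)"
      by (simp add: has_field_derivative_def mult_commute_abs)
    have "(artanh has_real_derivative 1 / (1 - N\<^sup>2)) (at (cmod (Z s)))"
      unfolding N_def using ZD norm_ge_zero[of "Z s"] by (intro artanh_real_has_field_derivative) auto
    then have "((\<lambda>s. artanh (cmod (Z s))) has_real_derivative 1 / (1 - N\<^sup>2) * inner v (sgn (Z s))) (at s)"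
      by (rule DERIV_chain2[OF _ dN])
    then have "(\<psi> has_real_derivative cmod (deriv f 0) / \<beta> *
       (0 - exp (- \<beta> * artanh (cmod (Z s))) * (- \<beta> * (1 / (1 - N\<^sup>2) * inner v (sgn (Z s)))))) (at s)"
      unfolding \<psi>_def by (intro DERIV_cmult DERIV_diff DERIV_const DERIV_fun_exp)
    then have d\<psi>: "(\<psi> has_real_derivative
       cmod (deriv f 0) * exp (- \<beta> * artanh N) / (1 - N\<^sup>2) * inner v (sgn (Z s))) (at s)"
      using \<beta> by (simp add: N_def mult_ac)
    have "cmod (deriv f 0) * exp (- \<beta> * artanh N) / (1 - N\<^sup>2) \<le> cmod (deriv f (Z s))"
      using radial_distortion(2)[OF ord ZD] N1 by (simp add: N_def pos_divide_le_eq mult.commute)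
    moreover have "inner v (sgn (Z s)) \<le> cmod v"
      using norm_cauchy_schwarz[of v "sgn (Z s)"] Z0 by (simp add: norm_sgn)
    ultimately have "cmod (deriv f 0) * exp (- \<beta> * artanh N) / (1 - N\<^sup>2) * inner v (sgn (Z s))
        \<le> cmod (deriv f (Z s)) * cmod v"
      using N1 by (intro order_trans[OF mult_left_mono mult_right_mono]) auto
    then show "\<exists>y. ((\<lambda>s. s - \<psi> s) has_real_derivative y) (at s) \<and> 0 \<le> y"
      using DERIV_diff[OF DERIV_ident d\<psi>] unfolding v by (intro exI conjI) (assumption, simp)
  qed (use l in auto)
  moreover have "Z 0 = 0" "Z l = \<zeta>" using G(3) \<zeta>D d(2) by (auto simp: Z_def p_def simp flip: d(2))
  ultimately have "\<psi> l \<le> l" "\<psi> l = cmod (deriv f 0) * (1 - exp (- \<beta> * artanh r)) / \<beta>"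
    using \<zeta> by (auto simp: \<psi>_def)
  moreover have "l \<le> cmod (f z - f 0)" unfolding l_def using min[of z] by (simp add: r_def)
  ultimately show ?thesis by (simp add: r_def)
qed simp

section \<open>Composition with the disc automorphisms sending 0 to \<open>a\<close>\<close>

definition disc_shift :: "complex \<Rightarrow> complex \<Rightarrow> complex" where
  "disc_shift a z = (z + a) / (1 + cnj a * z)"

lemma disc_shift_denom_nonzero:
  assumes "a \<in> \<D>" "z \<in> \<D>"
  shows "1 + cnj a * z \<noteq> 0"
proof
  assume "1 + cnj a * z = 0"
  then have "cnj a * z = - 1" by (simp add: add_eq_0_iff)
  then have "cmod a * cmod z = 1" by (metis complex_mod_cnj norm_minus_cancel norm_mult norm_one)
  moreover have "cmod a * cmod z < 1 * 1" using assms by (intro mult_strict_mono) auto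
  ultimately show False by simp
qed

text \<open>The squared modulus of the denominator is kept as a product of two conjugate complex
  factors, because the invariance computation cancels just one of them.\<close>

lemma one_minus_norm_disc_shift:
  assumes "a \<in> \<D>" "z \<in> \<D>"
  shows "of_real (1 - (cmod (disc_shift a z))\<^sup>2) =
    of_real (1 - (cmod a)\<^sup>2) * of_real (1 - (cmod z)\<^sup>2) / ((1 + cnj a * z) * (1 + a * cnj z))"
proof -
  have 1: "1 + cnj a * z \<noteq> 0" using disc_shift_denom_nonzero[OF assms] .
  then have 2: "1 + a * cnj z \<noteq> 0" by (metis complex_cnj_add complex_cnj_cnj complex_cnj_mult complex_cnj_one complex_cnj_zero_iff)
  have "(1 + cnj a * z) * (1 + a * cnj z) - (z + a) * (cnj z + cnj a) = (1 - a * cnj a) * (1 - z * cnj z)"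
    by (simp add: algebra_simps)
  then have "1 - (z + a) / (1 + cnj a * z) * ((cnj z + cnj a) / (1 + a * cnj z)) =
      (1 - a * cnj a) * (1 - z * cnj z) / ((1 + cnj a * z) * (1 + a * cnj z))"
    using 1 2 by (simp add: diff_divide_eq_iff)
  then show ?thesis
    unfolding of_real_diff of_real_1 complex_norm_square disc_shift_def by simp
qed

lemma disc_shift_in_disc:
  assumes "a \<in> \<D>" "z \<in> \<D>"
  shows "disc_shift a z \<in> \<D>"
proof -
  have "1 + a * cnj z = cnj (1 + cnj a * z)" by simp
  then have "of_real (1 - (cmod (disc_shift a z))\<^sup>2) =
      (of_real ((1 - (cmod a)\<^sup>2) * (1 - (cmod z)\<^sup>2) / (cmod (1 + cnj a * z))\<^sup>2) :: complex)"
    unfolding one_minus_norm_disc_shift[OF assms] by (simp only: of_real_divide of_real_mult complex_norm_square)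
  then have "1 - (cmod (disc_shift a z))\<^sup>2 = (1 - (cmod a)\<^sup>2) * (1 - (cmod z)\<^sup>2) / (cmod (1 + cnj a * z))\<^sup>2"
    by (simp only: of_real_eq_iff)
  also have "\<dots> > 0"
    using disc_shift_denom_nonzero[OF assms] one_minus_norm_sq_pos[OF assms(1)] one_minus_norm_sq_pos[OF assms(2)]
    by simp
  finally show ?thesis by (simp add: abs_square_less_1)
qed

text \<open>With D = 1 + cnj a z, the automorphism T has derivative (1 - |a|^2)/D^2. The expression
  in the order condition for f o T at z is then cnj D / D, which is unimodular, times the expression
  for f at T(z).\<close>

lemma disc_shift_distortion_order:
  assumes ord: "distortion_order \<beta> f" and a: "a \<in> \<D>"
  shows "distortion_order \<beta> (\<lambda>z. f (disc_shift a z))"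
    and "deriv (\<lambda>z. f (disc_shift a z)) 0 = of_real (1 - (cmod a)\<^sup>2) * deriv f a"
proof -
  let ?T = "disc_shift a" and ?F = "\<lambda>z. f (disc_shift a z)"
  define D where "D = (\<lambda>z. 1 + cnj a * z)"
  define c where "c = (of_real (1 - (cmod a)\<^sup>2) :: complex)"
  have c: "c \<noteq> 0" using one_minus_norm_sq_pos[OF a] by (simp only: c_def of_real_eq_0_iff)
  have D: "D z \<noteq> 0" if "z \<in> \<D>" for z using disc_shift_denom_nonzero[OF a that] by (simp add: D_def)
  have hol: "f holomorphic_on \<D>" using ord by (simp add: distortion_order_def)
  then have hol': "deriv f holomorphic_on \<D>" using holomorphic_deriv by blast
  have nz: "deriv f z \<noteq> 0" if "z \<in> \<D>" for z using ord that unfolding distortion_order_def by blast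
  have cnja: "c = 1 - a * cnj a" unfolding c_def of_real_diff of_real_1 complex_norm_square ..
  have dT: "(?T has_field_derivative c / (D z)\<^sup>2) (at z)" if "z \<in> \<D>" for z
    unfolding disc_shift_def using D[OF that]
    by (auto intro!: derivative_eq_intros simp: D_def cnja power2_eq_square field_simps)
  have dF: "(?F has_field_derivative deriv f (?T z) * (c / (D z)\<^sup>2)) (at z)" if "z \<in> \<D>" for z
    by (rule DERIV_chain2[OF holomorphic_derivI[OF hol open_ball disc_shift_in_disc[OF a that]] dT[OF that]])
  have derF: "deriv ?F z = deriv f (?T z) * (c / (D z)\<^sup>2)" if "z \<in> \<D>" for z
    using DERIV_imp_deriv[OF dF[OF that]] .
  have "(deriv ?F has_field_derivative
      deriv (deriv f) (?T z) * (c / (D z)\<^sup>2) * (c / (D z)\<^sup>2) + (- 2 * cnj a * c / (D z)^3) * deriv f (?T z)) (at z)"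
    if z: "z \<in> \<D>" for z
  proof -
    have "((\<lambda>z. c / (D z)\<^sup>2) has_field_derivative (- 2 * cnj a * c / (D z)^3)) (at z)"
    proof -
      have "((\<lambda>w. c / w\<^sup>2) has_field_derivative (- 2 * c / (D z)^3)) (at (D z))"
        using D[OF z] by (auto intro!: derivative_eq_intros simp: power2_eq_square power3_eq_cube mult_ac)
      moreover have "(D has_field_derivative cnj a) (at z)"
        unfolding D_def by (auto intro!: derivative_eq_intros)
      ultimately show ?thesis
        using DERIV_chain2[of "\<lambda>w. c / w\<^sup>2" "- 2 * c / (D z)^3" D z "cnj a"] by (simp add: mult_ac)
    qed
    then have "((\<lambda>z. deriv f (?T z) * (c / (D z)\<^sup>2)) has_field_derivative
      deriv (deriv f) (?T z) * (c / (D z)\<^sup>2) * (c / (D z)\<^sup>2) + (- 2 * cnj a * c / (D z)^3) * deriv f (?T z)) (at z)"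
      by (rule DERIV_mult[OF DERIV_chain2[OF holomorphic_derivI[OF hol' open_ball disc_shift_in_disc[OF a z]] dT[OF z]]])
    then show ?thesis
      by (rule has_field_derivative_transform_within_open[OF _ open_ball z]) (simp add: derF)
  qed
  then have ddF: "deriv (deriv ?F) z =
      deriv (deriv f) (?T z) * (c / (D z)\<^sup>2) * (c / (D z)\<^sup>2) + (- 2 * cnj a * c / (D z)^3) * deriv f (?T z)"
    if z: "z \<in> \<D>" for z using that DERIV_imp_deriv by blast
  have "cmod (of_real (1 - (cmod z)\<^sup>2) * (deriv (deriv ?F) z / deriv ?F z) - 2 * cnj z) \<le> \<beta>" if z: "z \<in> \<D>" for z
  proof -
    define q where "q = deriv (deriv f) (?T z) / deriv f (?T z)"
    have TD: "?T z \<in> \<D>" using disc_shift_in_disc[OF a z] .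
    have ratio: "deriv (deriv ?F) z / deriv ?F z = q * (c / (D z)\<^sup>2) - 2 * cnj a / D z"
      unfolding derF[OF z] ddF[OF z] q_def using c D[OF z] nz[OF TD]
      by (simp add: field_simps power2_eq_square power3_eq_cube)
    have Dc: "cnj (D z) = 1 + a * cnj z" "cnj (D z) \<noteq> 0"
      by (simp add: D_def, simp only: complex_cnj_zero_iff D[OF z] not_False_eq_True)
    have "of_real (1 - (cmod z)\<^sup>2) * (deriv (deriv ?F) z / deriv ?F z) - 2 * cnj z =
          cnj (D z) / D z * (of_real (1 - (cmod (?T z))\<^sup>2) * q - 2 * cnj (?T z))"
    proof -
      have Dz: "1 + cnj a * z = D z" by (simp add: D_def)
      have 1: "cnj (D z) / D z * of_real (1 - (cmod (?T z))\<^sup>2) = of_real (1 - (cmod z)\<^sup>2) * (c / (D z)\<^sup>2)"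
        unfolding one_minus_norm_disc_shift[OF a z] Dc(1)[symmetric] c_def[symmetric] Dz
        using Dc(2) D[OF z] by (simp add: power2_eq_square mult_ac)
      have "cnj (?T z) = (cnj z + cnj a) / cnj (D z)" by (simp add: disc_shift_def D_def)
      then have "cnj (D z) / D z * (2 * cnj (?T z)) = 2 * (cnj z + cnj a) / D z"
        using Dc(2) by simp
      also have "\<dots> = of_real (1 - (cmod z)\<^sup>2) * (2 * cnj a / D z) + 2 * cnj z"
      proof -
        have "of_real (1 - (cmod z)\<^sup>2) * (2 * cnj a) + 2 * cnj z * D z = 2 * (cnj z + cnj a)"
          unfolding of_real_diff of_real_1 complex_norm_square D_def by (simp add: algebra_simps)
        then show ?thesis using D[OF z] by (metis add_divide_distrib nonzero_mult_div_cancel_right times_divide_eq_right)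
      qed
      finally show ?thesis using 1 unfolding ratio by (simp add: right_diff_distrib mult.assoc[symmetric])
    qed
    also have "cmod \<dots> = cmod (of_real (1 - (cmod (?T z))\<^sup>2) * q - 2 * cnj (?T z))"
      using D[OF z] by (simp add: norm_mult norm_divide)
    also have "\<dots> \<le> \<beta>" using ord TD unfolding distortion_order_def q_def by blast
    finally show ?thesis .
  qed
  moreover have "?F holomorphic_on \<D>" using dF unfolding holomorphic_on_open[OF open_ball] by blast
  moreover have "deriv ?F z \<noteq> 0" if "z \<in> \<D>" for z
    using derF[OF that] c D[OF that] nz[OF disc_shift_in_disc[OF a that]] by simp
  ultimately show "distortion_order \<beta> ?F" unfolding distortion_order_def by blast
  show "deriv ?F 0 = of_real (1 - (cmod a)\<^sup>2) * deriv f a"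
    using derF[of 0] by (simp add: D_def disc_shift_def c_def)
qed

lemma disc_shift_shift_back:
  assumes a: "a \<in> \<D>" and b: "b \<in> \<D>"
  shows "disc_shift a (disc_shift (- a) b) = b"
proof -
  have a': "- a \<in> \<D>" using a by simp
  have 1: "1 - cnj a * b \<noteq> 0" using disc_shift_denom_nonzero[OF a' b] by simp
  have "1 - cnj a * a = of_real (1 - (cmod a)\<^sup>2)"
    unfolding of_real_diff of_real_1 complex_norm_square by simp
  then have 2: "1 - cnj a * a \<noteq> 0" using one_minus_norm_sq_pos[OF a] by (metis less_irrefl of_real_eq_0_iff)
  have "disc_shift (- a) b + a = b * (1 - cnj a * a) / (1 - cnj a * b)"
       "1 + cnj a * disc_shift (- a) b = (1 - cnj a * a) / (1 - cnj a * b)"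
    using 1 by (simp_all add: disc_shift_def field_simps)
  then show ?thesis using 1 2 unfolding disc_shift_def[of a] by simp
qed

text \<open>The growth bounds at the origin are applied to \<open>f\<close> composed with
  \<open>disc_shift a\<close>, at the preimage \<zeta> of \<open>b\<close>; its modulus is the
  pseudohyperbolic distance from \<open>a\<close> to \<open>b\<close>.\<close>

lemma two_point_distortion_at:
  assumes ord: "distortion_order \<beta> f" and \<beta>: "\<beta> > 0" and inj: "inj_on f \<D>"
    and a: "a \<in> \<D>" and b: "b \<in> \<D>"
  shows "cmod (f a - f b) \<le> (1 - (cmod a)\<^sup>2) * cmod (deriv f a) * (exp (\<beta> * hyp_dist a b) - 1) / \<beta>"
    and "(1 - (cmod a)\<^sup>2) * cmod (deriv f a) * (1 - exp (- \<beta> * hyp_dist a b)) / \<beta> \<le> cmod (f a - f b)"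
proof -
  define \<zeta> where "\<zeta> = disc_shift (- a) b"
  have \<zeta>: "\<zeta> \<in> \<D>" unfolding \<zeta>_def using a b by (intro disc_shift_in_disc) auto
  have b': "disc_shift a \<zeta> = b" unfolding \<zeta>_def by (rule disc_shift_shift_back[OF a b])
  have dist: "hyp_dist a b = artanh (cmod \<zeta>)"
    by (simp add: hyp_dist_def pseudo_hyp_dist_def \<zeta>_def disc_shift_def norm_divide norm_minus_commute)
  have d0: "cmod (deriv (\<lambda>z. f (disc_shift a z)) 0) = (1 - (cmod a)\<^sup>2) * cmod (deriv f a)"
    unfolding disc_shift_distortion_order(2)[OF ord a] norm_mult norm_of_real
    using one_minus_norm_sq_pos[OF a] by simp
  have inj': "inj_on (\<lambda>z. f (disc_shift a z)) \<D>"
  proof (rule inj_onI)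
    fix x y assume xy: "x \<in> \<D>" "y \<in> \<D>" "f (disc_shift a x) = f (disc_shift a y)"
    then have "disc_shift a x = disc_shift a y"
      using inj_onD[OF inj] disc_shift_in_disc[OF a] by blast
    moreover have "disc_shift (- a) (disc_shift a w) = w" if "w \<in> \<D>" for w
      using disc_shift_shift_back[of "- a" w] a that by simp
    ultimately show "x = y" using xy by metis
  qed
  have fab: "cmod (f (disc_shift a \<zeta>) - f (disc_shift a 0)) = cmod (f a - f b)"
    unfolding b' by (simp add: disc_shift_def norm_minus_commute)
  note ord' = disc_shift_distortion_order(1)[OF ord a]
  show "cmod (f a - f b) \<le> (1 - (cmod a)\<^sup>2) * cmod (deriv f a) * (exp (\<beta> * hyp_dist a b) - 1) / \<beta>"
    using growth_upper[OF ord' \<beta> \<zeta>] unfolding fab d0 dist .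
  show "(1 - (cmod a)\<^sup>2) * cmod (deriv f a) * (1 - exp (- \<beta> * hyp_dist a b)) / \<beta> \<le> cmod (f a - f b)"
    using growth_lower[OF ord' \<beta> inj' \<zeta>] unfolding fab d0 dist .
qed

section \<open>Harmonic mappings\<close>

text \<open>Rotating \<open>y\<close> onto the ray of \<open>x\<close> serves both signs: the sum is
  then aligned and the difference opposed. A zero argument is given the direction 1.\<close>

lemma obtain_aligning_rotation:
  fixes x y :: complex
  obtains \<mu> where "cmod \<mu> = 1" "cmod (x + \<mu> * y) = cmod x + cmod y"
    "cmod (x - \<mu> * y) = \<bar>cmod x - cmod y\<bar>"
proof -
  have polar: "\<exists>s. cmod s = 1 \<and> z = of_real (cmod z) * s" for z :: complex
  proof (cases "z = 0")
    case False
    then show ?thesis by (intro exI[of _ "sgn z"] conjI) (simp add: norm_sgn, simp add: sgn_eq)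
  qed (auto intro: exI[of _ 1])
  obtain s t where s: "cmod s = 1" "x = of_real (cmod x) * s"
    and t: "cmod t = 1" "y = of_real (cmod y) * t" using polar by metis
  have "t \<noteq> 0" using t(1) by auto
  then have y: "s / t * y = of_real (cmod y) * s" by (subst t(2)) simp
  have "x + s / t * y = of_real (cmod x + cmod y) * s" "x - s / t * y = of_real (cmod x - cmod y) * s"
    unfolding y by (subst s(2), simp add: algebra_simps)+
  then show ?thesis
    using s(1) t(1) by (intro that[of "s / t"]) (simp_all only: norm_mult norm_divide norm_of_real, auto)
qed

text \<open>Taking out the unimodular factor \<mu> leaves a conjugate. This equality lets the
  \<mu>-dependent factors cancel in the comparison with the pre-Schwarzian.\<close>

lemma cnj_add_eq_norm_one_plus:
  assumes "cmod \<mu> = 1"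
  shows "cmod (\<mu> + cnj w) = cmod (1 + \<mu> * w)"
proof -
  have "\<mu> * cnj \<mu> = 1" using assms by (metis complex_norm_square of_real_1 one_power2)
  then have "\<mu> + cnj w = \<mu> * cnj (1 + \<mu> * w)" by (simp add: algebra_simps)
  then show ?thesis using assms by (metis complex_mod_cnj mult_1 norm_mult)
qed

text \<open>Here \<phi>' = h'(1 + \<mu>\<omega>), which is nonzero since |\<omega>| < 1, so
  \<phi>''/\<phi>' = h''/h' + \<mu>\<omega>'/(1 + \<mu>\<omega>). Subtracting the pre-Schwarzian
  leaves \<omega>'(\<mu> + cnj \<omega>)/((1 + \<mu>\<omega>)(1 - |\<omega>|^2)), whose modulus is
  independent of \<mu>.\<close>

lemma shear_becker:
  assumes h: "h holomorphic_on \<D>" and g: "g holomorphic_on \<D>"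
    and sp: "sense_preserving h g" and \<mu>: "cmod \<mu> = 1"
    and bound: "\<forall>z\<in>\<D>.
           (1 - (cmod z)\<^sup>2) * cmod (z * pre_schwarzian h g z) +
           cmod (z * deriv (dilatation h g) z) * (1 - (cmod z)\<^sup>2) / (1 - (cmod (dilatation h g z))\<^sup>2) \<le> 1"
  defines "\<phi> \<equiv> \<lambda>z. h z + \<mu> * g z"
  shows "\<phi> holomorphic_on \<D>"
    and "\<And>z. z \<in> \<D> \<Longrightarrow> deriv \<phi> z = deriv h z + \<mu> * deriv g z"
    and "\<And>z. z \<in> \<D> \<Longrightarrow> deriv \<phi> z \<noteq> 0"
    and "\<And>z. z \<in> \<D> \<Longrightarrow> (1 - (cmod z)\<^sup>2) * cmod (z * deriv (deriv \<phi>) z / deriv \<phi> z) \<le> 1"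
proof -
  let ?w = "dilatation h g"
  show "\<phi> holomorphic_on \<D>" unfolding \<phi>_def using h g by (intro holomorphic_intros)
  show der: "deriv \<phi> z = deriv h z + \<mu> * deriv g z" if "z \<in> \<D>" for z
    unfolding \<phi>_def using holomorphic_derivI[OF h open_ball that] holomorphic_derivI[OF g open_ball that]
    by (intro DERIV_imp_deriv DERIV_add DERIV_cmult)
  have lt: "cmod (deriv g z) < cmod (deriv h z)" if "z \<in> \<D>" for z
    using sp that power2_less_imp_less unfolding sense_preserving_def jacobian_def by force
  have h0: "deriv h z \<noteq> 0" if "z \<in> \<D>" for z using lt[OF that] by auto
  have w1: "cmod (?w z) < 1" if "z \<in> \<D>" for z
    using lt[OF that] h0[OF that] by (simp add: dilatation_def norm_divide)
  have den: "1 + \<mu> * ?w z \<noteq> 0" if "z \<in> \<D>" for z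
  proof
    assume "1 + \<mu> * ?w z = 0"
    then have "cmod (\<mu> * ?w z) = 1" by (metis add_eq_0_iff norm_minus_cancel norm_one)
    then show False using w1[OF that] \<mu> by (simp add: norm_mult)
  qed
  have der': "deriv \<phi> z = deriv h z * (1 + \<mu> * ?w z)" if "z \<in> \<D>" for z
    using der[OF that] h0[OF that] by (simp add: dilatation_def distrib_left)
  then show nz: "deriv \<phi> z \<noteq> 0" if "z \<in> \<D>" for z using that h0 den by simp
  have holh: "deriv h holomorphic_on \<D>" using h holomorphic_deriv by blast
  have holw: "?w holomorphic_on \<D>"
    unfolding dilatation_def using h0 by (intro holomorphic_intros h g holomorphic_deriv) auto
  fix z assume z: "z \<in> \<D>"
  have "((\<lambda>z. deriv h z * (1 + \<mu> * ?w z)) has_field_derivative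
      deriv (deriv h) z * (1 + \<mu> * ?w z) + (0 + \<mu> * deriv ?w z) * deriv h z) (at z)"
    by (intro DERIV_mult DERIV_add DERIV_cmult DERIV_const
        holomorphic_derivI[OF holh open_ball z] holomorphic_derivI[OF holw open_ball z])
  then have "(deriv \<phi> has_field_derivative
      deriv (deriv h) z * (1 + \<mu> * ?w z) + (0 + \<mu> * deriv ?w z) * deriv h z) (at z)"
    by (rule has_field_derivative_transform_within_open[OF _ open_ball z]) (simp add: der')
  then have dd: "deriv (deriv \<phi>) z = deriv (deriv h) z * (1 + \<mu> * ?w z) + \<mu> * deriv ?w z * deriv h z"
    using DERIV_imp_deriv by fastforce
  define s where "s = 1 - (cmod (?w z))\<^sup>2"
  have s: "s > 0" using w1[OF z] by (simp add: s_def abs_square_less_1)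
  have sw: "of_real s = 1 - ?w z * cnj (?w z)"
    unfolding s_def of_real_diff of_real_1 complex_norm_square ..
  have s0: "(of_real s :: complex) \<noteq> 0" using s by simp
  have "deriv (deriv \<phi>) z / deriv \<phi> z = deriv (deriv h) z / deriv h z + \<mu> * deriv ?w z / (1 + \<mu> * ?w z)"
    unfolding dd der'[OF z] using h0[OF z] den[OF z] by (simp add: add_divide_distrib mult.commute)
  also have "\<dots> = pre_schwarzian h g z +
       deriv ?w z * (\<mu> / (1 + \<mu> * ?w z) + cnj (?w z) / of_real s)"
    unfolding pre_schwarzian_def s_def[symmetric] by (simp add: algebra_simps)
  also have "\<mu> / (1 + \<mu> * ?w z) + cnj (?w z) / of_real s = (\<mu> + cnj (?w z)) / ((1 + \<mu> * ?w z) * of_real s)"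
  proof -
    have "\<mu> * of_real s + cnj (?w z) * (1 + \<mu> * ?w z) = \<mu> + cnj (?w z)"
      unfolding sw by (simp add: algebra_simps)
    then show ?thesis using add_frac_eq[OF den[OF z] s0, of \<mu> "cnj (?w z)"] by simp
  qed
  finally have "z * deriv (deriv \<phi>) z / deriv \<phi> z =
      z * pre_schwarzian h g z + z * deriv ?w z * ((\<mu> + cnj (?w z)) / ((1 + \<mu> * ?w z) * of_real s))"
    by (simp only: times_divide_eq_right[symmetric] distrib_left mult.assoc)
  then have "cmod (z * deriv (deriv \<phi>) z / deriv \<phi> z) \<le>
      cmod (z * pre_schwarzian h g z) + cmod (z * deriv ?w z * ((\<mu> + cnj (?w z)) / ((1 + \<mu> * ?w z) * of_real s)))"
    by (simp only: norm_triangle_ineq)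
  also have "cmod (z * deriv ?w z * ((\<mu> + cnj (?w z)) / ((1 + \<mu> * ?w z) * of_real s))) = cmod (z * deriv ?w z) / s"
    using den[OF z] s cnj_add_eq_norm_one_plus[OF \<mu>, of "?w z"] by (simp add: norm_mult norm_divide)
  finally have "(1 - (cmod z)\<^sup>2) * cmod (z * deriv (deriv \<phi>) z / deriv \<phi> z) \<le>
      (1 - (cmod z)\<^sup>2) * (cmod (z * pre_schwarzian h g z) + cmod (z * deriv ?w z) / s)"
    using one_minus_norm_sq_pos[OF z] by (intro mult_left_mono) auto
  also have "\<dots> \<le> 1" using bspec[OF bound z] by (simp add: s_def distrib_left mult.commute)
  finally show "(1 - (cmod z)\<^sup>2) * cmod (z * deriv (deriv \<phi>) z / deriv \<phi> z) \<le> 1" .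
qed

section \<open>Symmetry in the two points and geometric means\<close>

lemma hyp_dist_commute: "hyp_dist a b = hyp_dist b a"
proof -
  have "cmod (1 - cnj a * b) = cmod (cnj (1 - cnj a * b))" by (rule complex_mod_cnj[symmetric])
  also have "cnj (1 - cnj a * b) = 1 - cnj b * a" by (simp add: mult.commute)
  finally show ?thesis
    by (simp add: hyp_dist_def pseudo_hyp_dist_def norm_divide norm_minus_commute[of a b])
qed

lemma hyp_dist_nonneg:
  assumes "a \<in> \<D>" "b \<in> \<D>"
  shows "hyp_dist a b \<ge> 0"
proof -
  have "pseudo_hyp_dist a b = cmod (disc_shift (- a) b)"
    by (simp add: pseudo_hyp_dist_def disc_shift_def norm_divide norm_minus_commute)
  moreover have "disc_shift (- a) b \<in> \<D>" using assms by (intro disc_shift_in_disc) auto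
  ultimately have "0 \<le> pseudo_hyp_dist a b" "pseudo_hyp_dist a b < 1" by auto
  then show ?thesis unfolding hyp_dist_def artanh_def by (simp add: ln_ge_zero)
qed

text \<open>A bound through both \<open>p\<close> and \<open>q\<close> is a bound through the
  smaller one, which is at most their geometric mean; \<open>mult_sqrt_le\<close> is the dual with
  the larger one.\<close>

lemma le_mult_sqrt:
  fixes c p q x :: real
  assumes "x \<le> c * p" "x \<le> c * q" "0 \<le> c" "0 \<le> p" "0 \<le> q"
  shows "x \<le> c * sqrt (p * q)"
proof -
  have "min p q \<le> sqrt (p * q)"
    using assms by (intro real_le_rsqrt) (auto simp: min_def power2_eq_square mult_left_mono mult_right_mono)
  then have "c * min p q \<le> c * sqrt (p * q)" using assms by (intro mult_left_mono) auto
  then show ?thesis using assms by (simp add: min_def split: if_splits)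
qed

lemma mult_sqrt_le:
  fixes c p q x :: real
  assumes "c * p \<le> x" "c * q \<le> x" "0 \<le> c" "0 \<le> p" "0 \<le> q"
  shows "c * sqrt (p * q) \<le> x"
proof -
  have "sqrt (p * q) \<le> max p q"
    using assms by (intro real_le_lsqrt) (auto simp: max_def power2_eq_square mult_left_mono mult_right_mono)
  then have "c * sqrt (p * q) \<le> c * max p q" using assms by (intro mult_left_mono) auto
  then show ?thesis using assms by (simp add: max_def split: if_splits)
qed

theorem theorem2:
  fixes f h g \<omega> :: "complex \<Rightarrow> complex"
  assumes "harmonic_mapping f h g"
    and "sense_preserving h g"
    and "\<omega> = dilatation h g"
    and "\<And>z. z \<in> \<D> \<Longrightarrow>
           (1 - (cmod z)\<^sup>2) * cmod (z * pre_schwarzian h g z) +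
           cmod (z * deriv \<omega> z) * (1 - (cmod z)\<^sup>2) / (1 - (cmod (\<omega> z))\<^sup>2) \<le> 1"
    and "a \<in> \<D>" and "b \<in> \<D>"
  shows "1 / 3 * (exp (3 * hyp_dist a b) - 1) * sqrt (Q_fun h g a * Q_fun h g b)
           \<ge> cmod (f a - f b) \<and>
         cmod (f a - f b)
           \<ge> 1 / 3 * (1 - exp (- 3 * hyp_dist a b)) * sqrt (R_fun h g a * R_fun h g b)"
proof -
  have h: "h holomorphic_on \<D>" and g: "g holomorphic_on \<D>"
    using assms(1) by (auto simp: harmonic_mapping_def)
  have bound: "\<forall>z\<in>\<D>. (1 - (cmod z)\<^sup>2) * cmod (z * pre_schwarzian h g z) +
      cmod (z * deriv (dilatation h g) z) * (1 - (cmod z)\<^sup>2) / (1 - (cmod (dilatation h g z))\<^sup>2) \<le> 1"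
    using assms(4) unfolding assms(3) by blast
  have fab: "f a - f b = (h a - h b) + cnj (g a - g b)"
    using assms by (simp add: harmonic_mapping_def)
  have R0: "0 \<le> R_fun h g z" and Q0: "0 \<le> Q_fun h g z" if "z \<in> \<D>" for z
  proof -
    have "cmod (deriv g z) < cmod (deriv h z)"
      using assms(2) that power2_less_imp_less unfolding sense_preserving_def jacobian_def by force
    then show "0 \<le> R_fun h g z" "0 \<le> Q_fun h g z"
      using one_minus_norm_sq_pos[OF that] by (auto simp: R_fun_def Q_fun_def)
  qed
  define up where "up = 1 / 3 * (exp (3 * hyp_dist a b) - 1)"
  define lo where "lo = 1 / 3 * (1 - exp (- 3 * hyp_dist a b))"
  have ul: "up \<ge> 0" "lo \<ge> 0" using hyp_dist_nonneg[OF assms(5,6)] by (auto simp: up_def lo_def)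
  \<comment> \<open>The triangle inequalities for |h' + \<mu>g'| bring in \<open>Q_fun\<close> and
    \<open>R_fun\<close> at the first point. Stated for general \<open>x\<close> and
    \<open>y\<close>, the bounds apply to (a, b) and to (b, a).\<close>
  have shear: "cmod ((h x - h y) + \<mu> * (g x - g y)) \<le> up * Q_fun h g x"
      "lo * R_fun h g x \<le> cmod ((h x - h y) + \<mu> * (g x - g y))"
    if \<mu>: "cmod \<mu> = 1" and x: "x \<in> \<D>" and y: "y \<in> \<D>" and d: "hyp_dist x y = hyp_dist a b" for \<mu> x y
  proof -
    define \<phi> where "\<phi> = (\<lambda>z. h z + \<mu> * g z)"
    note becker = shear_becker[OF h g assms(2) \<mu> bound, folded \<phi>_def]
    have ord: "distortion_order 3 \<phi>"
      using becker_imp_distortion_order becker(1,3,4) by blast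
    have inj: "inj_on \<phi> \<D>" using becker_univalence becker(1,3,4) by blast
    have \<phi>: "\<phi> x - \<phi> y = (h x - h y) + \<mu> * (g x - g y)" by (simp add: \<phi>_def algebra_simps)
    have "cmod (deriv \<phi> x) \<le> cmod (deriv h x) + cmod (deriv g x)"
      using norm_triangle_ineq[of "deriv h x" "\<mu> * deriv g x"] \<mu> by (simp add: becker(2)[OF x] norm_mult)
    then have "(1 - (cmod x)\<^sup>2) * cmod (deriv \<phi> x) \<le> Q_fun h g x"
      unfolding Q_fun_def using one_minus_norm_sq_pos[OF x] by (intro mult_left_mono) auto
    then have "up * ((1 - (cmod x)\<^sup>2) * cmod (deriv \<phi> x)) \<le> up * Q_fun h g x"
      using ul by (intro mult_left_mono)
    moreover have "cmod (\<phi> x - \<phi> y) \<le> up * ((1 - (cmod x)\<^sup>2) * cmod (deriv \<phi> x))"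
      using two_point_distortion_at(1)[OF ord _ inj x y] by (simp add: up_def d mult_ac)
    ultimately show "cmod ((h x - h y) + \<mu> * (g x - g y)) \<le> up * Q_fun h g x" unfolding \<phi> by linarith
    have "cmod (deriv h x) - cmod (deriv g x) \<le> cmod (deriv \<phi> x)"
      using norm_diff_ineq[of "deriv h x" "\<mu> * deriv g x"] \<mu> by (simp add: becker(2)[OF x] norm_mult)
    then have "R_fun h g x \<le> (1 - (cmod x)\<^sup>2) * cmod (deriv \<phi> x)"
      unfolding R_fun_def using one_minus_norm_sq_pos[OF x] by (intro mult_left_mono) auto
    then have "lo * R_fun h g x \<le> lo * ((1 - (cmod x)\<^sup>2) * cmod (deriv \<phi> x))"
      using ul by (intro mult_left_mono)
    moreover have "lo * ((1 - (cmod x)\<^sup>2) * cmod (deriv \<phi> x)) \<le> cmod (\<phi> x - \<phi> y)"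
      using two_point_distortion_at(2)[OF ord _ inj x y] by (simp add: lo_def d mult_ac)
    ultimately show "lo * R_fun h g x \<le> cmod ((h x - h y) + \<mu> * (g x - g y))" unfolding \<phi> by linarith
  qed
  have swap: "cmod ((h b - h a) + \<mu> * (g b - g a)) = cmod ((h a - h b) + \<mu> * (g a - g b))" for \<mu>
  proof -
    have "(h b - h a) + \<mu> * (g b - g a) = - ((h a - h b) + \<mu> * (g a - g b))" by (simp add: algebra_simps)
    then show ?thesis by (simp only: norm_minus_cancel)
  qed
  obtain \<mu> where \<mu>: "cmod \<mu> = 1"
    "cmod ((h a - h b) + \<mu> * (g a - g b)) = cmod (h a - h b) + cmod (g a - g b)"
    "cmod ((h a - h b) - \<mu> * (g a - g b)) = \<bar>cmod (h a - h b) - cmod (g a - g b)\<bar>"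
    using obtain_aligning_rotation .
  have upper: "cmod (f a - f b) \<le> cmod ((h a - h b) + \<mu> * (g a - g b))"
    unfolding fab \<mu>(2) by (metis complex_mod_cnj norm_triangle_ineq)
  \<comment> \<open>The opposite rotation sets the two increments against each other, so the left
    side is the difference of their moduli, the least value allowed by the reverse triangle
    inequality.\<close>
  have lower: "cmod ((h a - h b) + (- \<mu>) * (g a - g b)) \<le> cmod (f a - f b)"
    using \<mu>(3) norm_triangle_ineq3[of "h a - h b" "- cnj (g a - g b)"] unfolding fab
    by (simp del: complex_cnj_diff)
  have "cmod (f a - f b) \<le> up * sqrt (Q_fun h g a * Q_fun h g b)"
    using shear(1)[OF \<mu>(1) assms(5,6)] shear(1)[OF \<mu>(1) assms(6,5)] upper swap[of \<mu>] hyp_dist_commute[of b a]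
    by (intro le_mult_sqrt ul Q0 assms) auto
  moreover have "lo * sqrt (R_fun h g a * R_fun h g b) \<le> cmod (f a - f b)"
    using shear(2)[of "- \<mu>", OF _ assms(5,6)] shear(2)[of "- \<mu>", OF _ assms(6,5)] \<mu>(1) lower
      swap[of "- \<mu>"] hyp_dist_commute[of b a]
    by (intro mult_sqrt_le ul R0 assms) auto
  ultimately show ?thesis by (simp add: up_def lo_def)
qed

end
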